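(* Let $G$ be an acyclic network with a source $S$, distinct destinations $\mathcal T=\{T_1,\dots,T_K\}$ (not containing $S$), and a set of connections $\mathcal C=\{(S,T_i,\mathcal X(S,T_i)) : i=1,2,\dots,K\}$ that is a disjoint multicast, i.e. $\mathcal X(S,T_i)\cap\mathcal X(S,T_j)=\emptyset$ for all $i\ne j$. Then $(G,\mathcal C)$ is solvable if and only if $$mincut(S,\mathcal T')\ \ge\ \sum_{T_i\in\mathcal T'}|\mathcal X(S,T_i)|\qquad\text{for any (nonempty) }\mathcal T'\subseteq\mathcal T.$$
   Context: Network. $G=(\mathcal V,\mathcal E)$ consists of a finite set $\mathcal V$ of nodes; each node $V$ has a finite set $I(V)$ of input ports and a finite set $O(V)$ of output ports (all pairwise disjoint). Each edge in $\mathcal E$ is an ordered pair $(e_1,e_2)$ with $e_1\in O(V_1)$ and $e_2\in I(V_2)$ for some $V_1,V_2\in\mathcal V$. $G$ is acyclic if the directed graph on $\mathcal V$ with an arc $V_1\to V_2$ whenever some edge goes from $O(V_1)$ to $I(V_2)$ has no directed cycle. Linear transmission over a finite field. The source $S$ has independent symbols $\mathcal X(S)=[X(S,1),\dots,X(S,\mu(S))]$, $\mu(S)\le|O(S)|$, and $\mathcal X(S,T_i)\subseteq\mathcal X(S)$ is the set of processes demanded by $T_i$. $Y(e)$ denotes the symbol at port $e$. For $e\in O(V)$: $Y(e)=\sum_{e'\in I(V)}\beta_{(e',e)}Y(e')$, plus $\sum_i\alpha_{(i,e)}X(S,i)$ if $V=S$. For an input port $e'$: $Y(e')=\sum_{(e,e')\in\mathcal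 E}Y(e)$. A destination $T$ forms $Z(T,k)=\sum_{e'\in I(T)}\epsilon_{(e',(T,k))}Y(e')$, $1\le k\le\nu(T)$. The coefficients $\alpha,\beta,\epsilon$ are free. A connection $(S,T,\mathcal X(S,T))$ is established if the processes of $\mathcal X(S,T)$ are among the components of $\mathcal Z(T)=[Z(T,1),\dots,Z(T,\nu(T))]$, for all values of the source symbols. Solvability and field size. A base finite field $\mathbb F_q$ is given; the field size is not restricted, so $(G,\mathcal C)$ is called solvable if for some finite extension field of $\mathbb F_q$ (with symbols, coefficients and additions in it) the coefficients can be chosen so that all connections in $\mathcal C$ are established simultaneously. Min-cut. $mincut(S,\mathcal T')=\min_\Omega\operatorname{rank}(G_\Omega)$ over all $\Omega\subseteq\mathcal V$ with $S\in\Omega$ and $\mathcal T'\subseteq\Omega^c$, where $G_\Omega$ is the $0$-$1$ matrix over $\mathbb F_q$ with rows the output ports of nodes in $\Omega$, columns the input ports of nodes in $\Omega^c$, and entry $1$ exactly when there is an edge from the row port to the column port. *)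

theory Defs
  imports
    "HOL-Algebra.Algebraic_Closure_Type"
    "HOL-Library.Disjoint_Sets"
    "Jordan_Normal_Form.DL_Rank"
begin

section \<open>Networks with ports\<close>

record ('v, 'p) network =
  nodes :: "'v set"
  inp :: "'v \<Rightarrow> 'p set"
  outp :: "'v \<Rightarrow> 'p set"
  edges :: "('p \<times> 'p) set"

definition network :: "('v, 'p) network \<Rightarrow> bool" where
  "network G \<longleftrightarrow>
     finite (nodes G) \<and>
     (\<forall>V\<in>nodes G. finite (inp G V) \<and> finite (outp G V)) \<and>
     disjoint_family_on (inp G) (nodes G) \<and>
     disjoint_family_on (outp G) (nodes G) \<and>
     (\<forall>V\<in>nodes G. \<forall>W\<in>nodes G. inp G V \<inter> outp G W = {}) \<and>
     edges G \<subseteq> (\<Union>V\<in>nodes G. outp G V) \<times> (\<Union>V\<in>nodes G. inp G V)"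

definition arcs :: "('v, 'p) network \<Rightarrow> ('v \<times> 'v) set" where
  "arcs G = {(V, W). V \<in> nodes G \<and> W \<in> nodes G \<and>
                     (\<exists>e\<in>outp G V. \<exists>e'\<in>inp G W. (e, e') \<in> edges G)}"

definition acyclic_network :: "('v, 'p) network \<Rightarrow> bool" where
  "acyclic_network G \<longleftrightarrow> network G \<and> acyclic (arcs G)"


section \<open>Min-cut\<close>

text \<open>
  Library matrices are indexed by initial segments of the natural numbers, so the ports on the two
  sides of a cut are enumerated in an arbitrary order; the rank does not depend on that order.
\<close>

definition enum_list :: "'a set \<Rightarrow> 'a list" where
  "enum_list A = (SOME xs. distinct xs \<and> set xs = A)"

definition cut_matrix :: "('v, 'p) network \<Rightarrow> 'v set \<Rightarrow> 'q::field mat" where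
  "cut_matrix G \<Omega> =
     (let rs = enum_list (\<Union>V\<in>\<Omega>. outp G V);
          cs = enum_list (\<Union>V\<in>nodes G - \<Omega>. inp G V)
      in mat (length rs) (length cs) (\<lambda>(i, j). if (rs ! i, cs ! j) \<in> edges G then 1 else 0))"

definition cut_rank :: "'q::field itself \<Rightarrow> ('v, 'p) network \<Rightarrow> 'v set \<Rightarrow> nat" where
  "cut_rank _ G \<Omega> =
     (let M = (cut_matrix G \<Omega> :: 'q mat) in vec_space.rank (dim_row M) M)"

definition mincut :: "'q::field itself \<Rightarrow> ('v, 'p) network \<Rightarrow> 'v \<Rightarrow> 'v set \<Rightarrow> nat" where
  "mincut q G S \<T>' =
     Min (cut_rank q G ` {\<Omega>. \<Omega> \<subseteq> nodes G \<and> S \<in> \<Omega> \<and> \<T>' \<subseteq> nodes G - \<Omega>})"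


section \<open>Linear transmission\<close>

text \<open>
  \<open>port_symbols G S \<mu> \<alpha> \<beta> x Y\<close>: \<open>Y\<close> assigns to the ports the symbols that arise when \<open>x 1, \<dots>, x \<mu>\<close>
  are the source symbols.  On an acyclic network such a \<open>Y\<close> always exists
  (\<open>port_symbols_exist\<close> below) and is unique on the ports.
\<close>

definition port_symbols ::
  "('v, 'p) network \<Rightarrow> 'v \<Rightarrow> nat \<Rightarrow> (nat \<Rightarrow> 'p \<Rightarrow> 'f) \<Rightarrow> ('p \<Rightarrow> 'p \<Rightarrow> 'f)
     \<Rightarrow> (nat \<Rightarrow> 'f) \<Rightarrow> ('p \<Rightarrow> 'f::field) \<Rightarrow> bool" where
  "port_symbols G S \<mu> \<alpha> \<beta> x Y \<longleftrightarrow>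
     (\<forall>V\<in>nodes G. \<forall>e\<in>outp G V.
        Y e = (\<Sum>e'\<in>inp G V. \<beta> e' e * Y e') + (if V = S then \<Sum>i\<in>{1..\<mu>}. \<alpha> i e * x i else 0)) \<and>
     (\<forall>V\<in>nodes G. \<forall>e'\<in>inp G V. Y e' = (\<Sum>e\<in>{e. (e, e') \<in> edges G}. Y e))"

text \<open>
  A demand is a set of indices of source processes.  The output component \<open>k\<close> carrying process \<open>i\<close>
  may not depend on the values of the source symbols, hence the order of the quantifiers.
\<close>

definition connection_established ::
  "('v, 'p) network \<Rightarrow> 'v \<Rightarrow> nat \<Rightarrow> 'f::field set
     \<Rightarrow> (nat \<Rightarrow> 'p \<Rightarrow> 'f) \<Rightarrow> ('p \<Rightarrow> 'p \<Rightarrow> 'f) \<Rightarrow> ('p \<Rightarrow> 'v \<times> nat \<Rightarrow> 'f) \<Rightarrow> ('v \<Rightarrow> nat)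
     \<Rightarrow> 'v \<Rightarrow> nat set \<Rightarrow> bool" where
  "connection_established G S \<mu> L \<alpha> \<beta> \<epsilon> \<nu> T D \<longleftrightarrow>
     (\<forall>i\<in>D. \<exists>k\<in>{1..\<nu> T}. \<forall>x Y.
        (\<forall>j\<in>{1..\<mu>}. x j \<in> L) \<longrightarrow> port_symbols G S \<mu> \<alpha> \<beta> x Y \<longrightarrow>
        (\<Sum>e'\<in>inp G T. \<epsilon> e' (T, k) * Y e') = x i)"

text \<open>
  The base field is the type \<open>'q\<close>.  Its finite extension fields are taken inside its algebraic
  closure, which contains each of them up to isomorphism over \<open>'q\<close>.
\<close>

definition finite_extension_field :: "'q::{field,finite} alg_closure set \<Rightarrow> bool" where
  "finite_extension_field L \<longleftrightarrow>
     finite L \<and> subfield L ring_of_type_algebra \<and> range to_ac \<subseteq> L"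

definition solvable ::
  "'q::{field,finite} itself \<Rightarrow> ('v, 'p) network \<Rightarrow> 'v \<Rightarrow> nat \<Rightarrow> ('v \<times> 'v \<times> nat set) set \<Rightarrow> bool" where
  "solvable _ G S \<mu> \<C> \<longleftrightarrow>
     (\<exists>L :: 'q alg_closure set. finite_extension_field L \<and>
       (\<exists>\<alpha> \<beta> \<epsilon> \<nu>.
          (\<forall>i e. \<alpha> i e \<in> L) \<and> (\<forall>e' e. \<beta> e' e \<in> L) \<and> (\<forall>e' Tk. \<epsilon> e' Tk \<in> L) \<and>
          (\<forall>(S', T, D)\<in>\<C>. S' = S \<and> connection_established G S \<mu> L \<alpha> \<beta> \<epsilon> \<nu> T D)))"

definition connections :: "'v \<Rightarrow> 'v set \<Rightarrow> ('v \<Rightarrow> nat set) \<Rightarrow> ('v \<times> 'v \<times> nat set) set" where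
  "connections S \<T> dem = (\<lambda>T. (S, T, dem T)) ` \<T>"


section \<open>Port symbols exist on acyclic networks\<close>

lemma port_symbols_exist:
  fixes \<alpha> :: "nat \<Rightarrow> 'p \<Rightarrow> 'f::field" and G :: "('v, 'p) network"
  assumes "acyclic_network G"
  shows "\<exists>Y. port_symbols G S \<mu> \<alpha> \<beta> x Y"
proof -
  have net: "network G" and acyc: "acyclic (arcs G)"
    using assms by (auto simp: acyclic_network_def)
  have finN: "finite (nodes G)" using net by (simp add: network_def)
  have "finite (arcs G)"
    by (rule finite_subset[of _ "nodes G \<times> nodes G"]) (auto simp: arcs_def finN)
  then have wfc: "wf ((arcs G)\<inverse>)" using acyc by (rule finite_acyclic_wf_converse)
  let ?O = "\<lambda>Y V. \<forall>e\<in>outp G V. Y e = (\<Sum>e'\<in>inp G V. \<beta> e' e * Y e') +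
              (if V = S then \<Sum>i\<in>{1..\<mu>}. \<alpha> i e * x i else (0::'f))"
  let ?I = "\<lambda>Y V. \<forall>e'\<in>inp G V. Y e' = (\<Sum>e\<in>{e. (e, e') \<in> edges G}. Y e :: 'f)"
  have outdisj: "V = W" if "V \<in> nodes G" "W \<in> nodes G" "e \<in> outp G V" "e \<in> outp G W" for V W e
    using net that unfolding network_def disjoint_family_on_def by blast
  have indisj: "V = W" if "V \<in> nodes G" "W \<in> nodes G" "e \<in> inp G V" "e \<in> inp G W" for V W e
    using net that unfolding network_def disjoint_family_on_def by blast
  have iodisj: False if "V \<in> nodes G" "W \<in> nodes G" "e \<in> inp G V" "e \<in> outp G W" for V W e
    using net that unfolding network_def by blast
  have "\<exists>Y. \<forall>V\<in>W. ?O Y V \<and> ?I Y V"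
    if "finite W" "W \<subseteq> nodes G" "\<And>A B. (A, B) \<in> arcs G \<Longrightarrow> B \<in> W \<Longrightarrow> A \<in> W" for W
    using that
  proof (induction "card W" arbitrary: W)
    case 0
    then show ?case by simp
  next
    case (Suc n)
    then have "W \<noteq> {}" by auto
    then obtain v where v: "v \<in> W" and vmax: "\<And>B. (v, B) \<in> arcs G \<Longrightarrow> B \<notin> W"
      using wfE_min'[OF wfc, of W] by (metis converse_iff)
    have vN: "v \<in> nodes G" using v Suc.prems by auto
    let ?W = "W - {v}"
    have "\<exists>Y. \<forall>V\<in>?W. ?O Y V \<and> ?I Y V"
    proof (rule Suc.hyps(1))
      show "n = card ?W" using Suc.hyps(2) Suc.prems(1) v by simp
      show "finite ?W" "?W \<subseteq> nodes G" using Suc.prems(1,2) by auto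
      show "A \<in> ?W" if "(A, B) \<in> arcs G" "B \<in> ?W" for A B
        using Suc.prems(3)[of A B] vmax[of B] that by auto
    qed
    then obtain Y where Y: "\<forall>V\<in>?W. ?O Y V \<and> ?I Y V" by blast
    define Y1 where "Y1 = (\<lambda>p. if p \<in> inp G v then \<Sum>e\<in>{e. (e, p) \<in> edges G}. Y e else Y p)"
    define Y2 where "Y2 = (\<lambda>p. if p \<in> outp G v then (\<Sum>e'\<in>inp G v. \<beta> e' p * Y1 e') +
              (if v = S then \<Sum>i\<in>{1..\<mu>}. \<alpha> i p * x i else 0) else Y1 p)"
    have Y2in: "Y2 p = Y1 p" if "V \<in> nodes G" "p \<in> inp G V" for V p
      using iodisj[OF that(1) vN that(2)] by (auto simp: Y2_def)
    have src: "Y2 e = Y e" if "V \<in> W" "p \<in> inp G V" "(e, p) \<in> edges G" for V p e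
    proof -
      obtain U where U: "U \<in> nodes G" "e \<in> outp G U"
        using net \<open>(e, p) \<in> edges G\<close> unfolding network_def by blast
      have VN: "V \<in> nodes G" using that Suc.prems by auto
      have "(U, V) \<in> arcs G" using U VN that by (auto simp: arcs_def)
      then have "U \<noteq> v" using vmax that by blast
      then have "e \<notin> outp G v" using outdisj U vN by blast
      moreover have "e \<notin> inp G v" using iodisj U vN by blast
      ultimately show ?thesis by (simp add: Y2_def Y1_def)
    qed
    have "?O Y2 V \<and> ?I Y2 V" if VW: "V \<in> W" for V
    proof (cases "V = v")
      case True
      have "?I Y2 v"
        using src[OF v] Y2in[OF vN] by (auto simp: Y1_def intro!: sum.cong)
      moreover have "?O Y2 v"
        using Y2in[OF vN] by (auto simp: Y2_def intro!: sum.cong)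
      ultimately show ?thesis using True by simp
    next
      case False
      then have V: "V \<in> ?W" and VN: "V \<in> nodes G" using VW Suc.prems by auto
      have in': "Y2 p = Y p" if "p \<in> inp G V" for p
        using Y2in[OF VN that] indisj[OF VN vN that] False by (auto simp: Y1_def)
      have out': "Y2 p = Y p" if "p \<in> outp G V" for p
        using outdisj[OF VN vN that] False iodisj[OF vN VN _ that] by (auto simp: Y2_def Y1_def)
      have "?I Y2 V"
        using Y V in' src[OF VW] by (metis (no_types, lifting) mem_Collect_eq sum.cong)
      moreover have "?O Y2 V"
        using Y V in' out' by (auto intro!: sum.cong)
      ultimately show ?thesis by blast
    qed
    then show ?case by blast
  qed
  from this[OF finN subset_refl] obtain Y where "\<forall>V\<in>nodes G. ?O Y V \<and> ?I Y V"
    by (auto simp: arcs_def)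
  then have "port_symbols G S \<mu> \<alpha> \<beta> x Y"
    unfolding port_symbols_def by blast
  then show ?thesis by blast
qed

end

(*
  Random linear coding.  Fix a nonzero input x.  If a code maps x to zero at all destinations, let
  \<Omega> consist of S and the nodes that receive a nonzero signal.  The signal leaving \<Omega> lies in the
  kernel of the cut matrix, and each of the |O(\<Omega>)| output symbols and of the demands inside \<Omega>
  is a linear constraint on a code.  Hence over a field with Q elements at most a fraction
  Q^-(rank + demands inside \<Omega>) of all codes fail on x with this \<Omega>, which the min-cut condition
  bounds by Q^-m, where m is the total demand.  Summing over the at most 2^|V| sets \<Omega> and over the
  (Q^m - 1) / (Q - 1) lines of inputs shows that some code is injective once Q > 2^|V|, and
  precoding at the source with the inverse of its end-to-end map meets all demands.
*)
theory Submission
  imports Defs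
begin

section \<open>Linear algebra over finite fields\<close>

text \<open>Signals depend nonlinearly on a code, so failing codes are hard to count directly. The
  count therefore runs over pairs of a code and a guessed signal: once the signal is fixed, its
  values become coefficients and every row of the code has its own linear equation, so the fractions
  multiply. There are at most Q^(|O(\<Omega>)| - rank) guesses, each met by at most a fraction
  Q^-(|O(\<Omega>)| + demands inside \<Omega>) of the codes, and |O(\<Omega>)| cancels. Disjointness
  gives each demanded process a single sink, so the end-to-end map is square and injectivity alone
  makes it invertible. The rank is taken over the base field, but codes live in an extension.
  Independence is therefore carried by a dual family of vectors, whose defining equations survive
  the field embedding. Necessity is a separate count: the symbols demanded beyond a cut are
  determined by rank-many values, so Q^demands is at most Q^rank.\<close>

text \<open>Padding with \<open>0\<close> instead of \<open>undefined\<close> lets pointwise sums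
  and multiples stay in the set and keeps every value in \<open>L\<close>.\<close>

definition coords :: "'f::zero set \<Rightarrow> 'a set \<Rightarrow> ('a \<Rightarrow> 'f) set" where
  "coords L A = {f. (\<forall>a\<in>A. f a \<in> L) \<and> (\<forall>a. a \<notin> A \<longrightarrow> f a = 0)}"

lemma bij_betw_coords: "bij_betw (\<lambda>f. restrict f A) (coords L A) (A \<rightarrow>\<^sub>E L)"
proof (rule bij_betw_byWitness[where f' = "\<lambda>g a. if a \<in> A then g a else 0"])
  show "\<forall>f\<in>coords L A. (\<lambda>a. if a \<in> A then restrict f A a else 0) = f"
    by (auto simp: coords_def fun_eq_iff)
  show "\<forall>g\<in>A \<rightarrow>\<^sub>E L. restrict (\<lambda>a. if a \<in> A then g a else 0) A = g"
    by (auto simp: fun_eq_iff PiE_def extensional_def)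
qed (auto simp: coords_def)

lemma card_coords: "finite A \<Longrightarrow> card (coords L A) = card L ^ card A"
  using bij_betw_same_card[OF bij_betw_coords, of L A] by (simp add: card_funcsetE)

lemma finite_coords: "finite A \<Longrightarrow> finite L \<Longrightarrow> finite (coords L A)"
  using bij_betw_finite[OF bij_betw_coords, of L A] by (simp add: finite_PiE)

section \<open>Dual families and rank factorisations\<close>

text \<open>Biorthogonalisation by induction on \<open>J\<close>. Unlike independence itself, the
  resulting equations can be transported along a field embedding.\<close>

lemma dual_family:
  fixes c :: "'j \<Rightarrow> 'n \<Rightarrow> 'a::field"
  assumes "finite N" "finite J"
    and "\<And>a. (\<forall>n\<in>N. (\<Sum>j\<in>J. a j * c j n) = 0) \<Longrightarrow> (\<forall>j\<in>J. a j = 0)"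
  shows "\<exists>b. \<forall>i\<in>J. \<forall>l\<in>J. (\<Sum>n\<in>N. c i n * b l n) = (if i = l then 1 else 0)"
  using assms(2,3)
proof (induction J rule: finite_induct)
  case empty
  then show ?case by simp
next
  case (insert j J)
  define dot :: "('n \<Rightarrow> 'a) \<Rightarrow> ('n \<Rightarrow> 'a) \<Rightarrow> 'a" where "dot u v = (\<Sum>n\<in>N. u n * v n)" for u v
  have dot_diff_sum: "dot u (\<lambda>n. v n - (\<Sum>i\<in>J. a i * w i n)) = dot u v - (\<Sum>i\<in>J. a i * dot u (w i))"
    for u v a w
  proof -
    have "dot u (\<lambda>n. v n - (\<Sum>i\<in>J. a i * w i n)) = dot u v - (\<Sum>n\<in>N. \<Sum>i\<in>J. u n * (a i * w i n))"
      by (simp add: dot_def right_diff_distrib sum_subtractf sum_distrib_left)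
    also have "(\<Sum>n\<in>N. \<Sum>i\<in>J. u n * (a i * w i n)) = (\<Sum>i\<in>J. \<Sum>n\<in>N. u n * (a i * w i n))"
      by (rule sum.swap)
    also have "\<dots> = (\<Sum>i\<in>J. a i * dot u (w i))"
      by (simp add: dot_def sum_distrib_left mult.left_commute)
    finally show ?thesis .
  qed
  have dot_commute: "dot u v = dot v u" for u v
    by (simp add: dot_def mult.commute)
  have "\<forall>i\<in>J. a i = 0" if a: "\<forall>n\<in>N. (\<Sum>i\<in>J. a i * c i n) = 0" for a
  proof -
    have "(\<Sum>i\<in>insert j J. (a(j := 0)) i * c i n) = (\<Sum>i\<in>J. a i * c i n)" for n
      using insert.hyps by (auto intro!: sum.cong)
    with a insert.prems[of "a(j := 0)"] have "\<forall>i\<in>insert j J. (a(j := 0)) i = 0" by simp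
    then show ?thesis using insert.hyps by (auto split: if_splits)
  qed
  from insert.IH[OF this] obtain b where
    b: "dot (c i) (b l) = (if i = l then 1 else 0)" if "i \<in> J" "l \<in> J" for i l
    unfolding dot_def by blast
  \<comment> \<open>\<open>c'\<close> is \<open>c j\<close> corrected so that it pairs to zero with
    every old dual vector. If it vanished on \<open>N\<close>, that would be a linear relation with
    coefficient \<open>1\<close> at \<open>j\<close>.\<close>
  define c' where "c' n = c j n - (\<Sum>i\<in>J. dot (c j) (b i) * c i n)" for n
  have "\<exists>m\<in>N. c' m \<noteq> 0"
  proof (rule ccontr)
    assume "\<not> ?thesis"
    then have c'0: "c' n = 0" if "n \<in> N" for n using that by blast
    define a where "a i = (if i = j then 1 else - dot (c j) (b i))" for i
    have "(\<Sum>i\<in>J. a i * c i n) = - (\<Sum>i\<in>J. dot (c j) (b i) * c i n)" for n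
      unfolding sum_negf[symmetric] using insert.hyps by (intro sum.cong) (auto simp: a_def)
    then have "(\<Sum>i\<in>insert j J. a i * c i n) = c' n" for n
      using insert.hyps by (simp add: c'_def a_def)
    with c'0 have "\<forall>n\<in>N. (\<Sum>i\<in>insert j J. a i * c i n) = 0" by simp
    from insert.prems[OF this] show False by (simp add: a_def)
  qed
  then obtain m where m: "m \<in> N" "c' m \<noteq> 0" by blast
  \<comment> \<open>A unit vector scaled so that \<open>dot c' b0 = 1\<close>. Removing multiples of
    the \<open>b i\<close> makes \<open>bj\<close> orthogonal to the old \<open>c i\<close> and
    keeps its pairing with \<open>c'\<close>.\<close>
  define b0 where "b0 n = (if n = m then 1 / c' m else 0)" for n
  define bj where "bj n = b0 n - (\<Sum>i\<in>J. dot (c i) b0 * b i n)" for n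
  have dot_bj: "dot u bj = dot u b0 - (\<Sum>i\<in>J. dot (c i) b0 * dot u (b i))" for u
    unfolding bj_def by (rule dot_diff_sum)
  have 1: "dot (c k) bj = 0" if "k \<in> J" for k
  proof -
    have "(\<Sum>i\<in>J. dot (c i) b0 * dot (c k) (b i)) = (\<Sum>i\<in>J. if i = k then dot (c i) b0 else 0)"
      using b that by (intro sum.cong) auto
    also have "\<dots> = dot (c k) b0" using that insert.hyps by simp
    finally show ?thesis by (simp add: dot_bj)
  qed
  have 2: "dot (c j) bj = 1"
  proof -
    have "dot c' b0 = (\<Sum>n\<in>N. if n = m then 1 else 0)"
      unfolding dot_def using m by (intro sum.cong) (auto simp: b0_def)
    also have "\<dots> = 1" using m assms(1) by simp
    finally have "dot b0 c' = 1" by (simp add: dot_commute)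
    moreover have "dot b0 c' = dot b0 (c j) - (\<Sum>i\<in>J. dot (c j) (b i) * dot b0 (c i))"
      unfolding c'_def by (rule dot_diff_sum)
    ultimately show ?thesis by (simp add: dot_bj dot_commute[of b0] mult.commute)
  qed
  \<comment> \<open>The multiple of \<open>bj\<close> cancels the pairing of \<open>b l\<close> with
    \<open>c j\<close>; the pairings with the old \<open>c i\<close> do not change.\<close>
  define b' where "b' l n = (if l = j then bj n else b l n - dot (c j) (b l) * bj n)" for l n
  have b'_j: "b' j = bj" by (simp add: b'_def fun_eq_iff)
  have dot_b': "dot u (b' l) = dot u (b l) - dot (c j) (b l) * dot u bj" if "l \<noteq> j" for u l
    unfolding dot_def[of u] using that
    by (simp add: b'_def right_diff_distrib sum_subtractf sum_distrib_left mult.left_commute)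
  have "dot (c i) (b' l) = (if i = l then 1 else 0)" if "i \<in> insert j J" "l \<in> insert j J" for i l
  proof (cases "l = j")
    case True
    then show ?thesis using 1 2 that insert.hyps by (auto simp: b'_j)
  next
    case False
    then show ?thesis using that 1 2 b insert.hyps by (auto simp: dot_b')
  qed
  then show ?case unfolding dot_def by blast
qed

text \<open>A maximal independent set of columns spans all columns, which gives \<open>k\<close>;
  its independence gives \<open>b\<close> by \<open>dual_family\<close>.\<close>

lemma (in vec_space) rank_factorisation:
  assumes A: "A \<in> carrier_mat n nc"
  obtains J k b where "J \<subseteq> {..<nc}" "card J = rank A"
    "\<And>i c. i < n \<Longrightarrow> c < nc \<Longrightarrow> A $$ (i, c) = (\<Sum>j\<in>J. k c j * A $$ (i, j))"
    "\<And>j l. j \<in> J \<Longrightarrow> l \<in> J \<Longrightarrow> (\<Sum>i<n. A $$ (i, j) * b l i) = (if j = l then 1 else 0)"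
proof -
  let ?P = "\<lambda>T. T \<subseteq> set (cols A) \<and> lin_indpt T"
  obtain B where B: "finite B" "maximal B ?P"
    using maximal_exists_superset[of "set (cols A)" ?P "{}"] by (auto simp: lin_dep_def)
  have cols: "set (cols A) = col A ` {..<nc}"
    using A by (auto simp: cols_def)
  have Bsub: "B \<subseteq> set (cols A)" and ind: "lin_indpt B" and
    max: "\<And>T. B \<subseteq> T \<Longrightarrow> T \<subseteq> set (cols A) \<Longrightarrow> lin_indpt T \<Longrightarrow> T = B"
    using B(2) unfolding maximal_def by (blast, blast, metis)
  have Bc: "B \<subseteq> carrier_vec n" using Bsub A cols_dim by blast
  \<comment> \<open>Equal columns collapse in \<open>set (cols A)\<close>, so one index is chosen
    for each vector of \<open>B\<close>.\<close>
  obtain J where J: "J \<subseteq> {..<nc}" "inj_on (col A) J" "B = col A ` J"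
    using Bsub unfolding cols subset_image_inj by blast
  have finJ: "finite J" using J(1) finite_subset by blast
  have ix: "lincomb a B $ i = (\<Sum>j\<in>J. a (col A j) * A $$ (i, j))" if "i < n" for a i
    using that A J by (subst lincomb_index[OF that Bc]) (auto simp: sum.reindex intro!: sum.cong)
  have "\<exists>a. lincomb a B = col A c" if "c < nc" for c
  proof -
    have cA: "col A c \<in> set (cols A)" "col A c \<in> carrier_vec n" using that A cols by auto
    have "col A c \<in> span B"
    proof (rule ccontr)
      assume *: "col A c \<notin> span B"
      then have nB: "col A c \<notin> B" using Bc span_mem by auto
      then have "lin_indpt (B \<union> {col A c})"
        using lin_dep_iff_in_span[of B "col A c"] Bc ind cA * by auto
      from max[OF _ _ this] Bsub cA nB show False by auto
    qed
    then show ?thesis using finite_in_span[OF B(1)] Bc by auto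
  qed
  then obtain a where a: "lincomb (a c) B = col A c" if "c < nc" for c by metis
  have "\<exists>b. \<forall>j\<in>J. \<forall>l\<in>J. (\<Sum>i\<in>{..<n}. A $$ (i, j) * b l i) = (if j = l then 1 else 0)"
  proof (rule dual_family[OF _ finJ, of "{..<n}" "\<lambda>j i. A $$ (i, j)"])
    fix a assume a: "\<forall>i\<in>{..<n}. (\<Sum>j\<in>J. a j * A $$ (i, j)) = 0"
    \<comment> \<open>\<open>lincomb\<close> takes coefficients on vectors, so those on indices are
      carried over the bijection \<open>col A\<close> from \<open>J\<close> to
      \<open>B\<close>.\<close>
    define a' where "a' v = a (the_inv_into J (col A) v)" for v
    have a': "a' (col A j) = a j" if "j \<in> J" for j
      using that J(2) by (simp add: a'_def the_inv_into_f_f)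
    have "lincomb a' B = 0\<^sub>v n"
    proof (rule eq_vecI)
      show "dim_vec (lincomb a' B) = dim_vec (0\<^sub>v n)"
        using lincomb_dim[OF B(1) Bc] by simp
      show "lincomb a' B $ i = 0\<^sub>v n $ i" if "i < dim_vec (0\<^sub>v n)" for i
        using that a a' by (simp add: ix)
    qed
    then have "\<not> (\<exists>v\<in>B. a' v \<noteq> 0)"
      using lin_dep_crit[OF B(1) subset_refl, where a = a'] ind by auto
    then show "\<forall>j\<in>J. a j = 0" using a' J(3) by auto
  qed simp
  then obtain b where b: "\<forall>j\<in>J. \<forall>l\<in>J. (\<Sum>i\<in>{..<n}. A $$ (i, j) * b l i) = (if j = l then 1 else 0)"
    by blast
  show ?thesis
  proof
    show "J \<subseteq> {..<nc}" by fact
    show "card J = rank A"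
      using rank_card_indpt[OF A B(2)] J(2,3) by (simp add: card_image)
    show "A $$ (i, c) = (\<Sum>j\<in>J. a c (col A j) * A $$ (i, j))" if "i < n" "c < nc" for i c
      using ix[OF that(1), of "a c"] a[OF that(2)] that A by simp
    show "(\<Sum>i<n. A $$ (i, j) * b l i) = (if j = l then 1 else 0)" if "j \<in> J" "l \<in> J" for j l
      using b that by auto
  qed
qed

text \<open>Ports replace matrix positions, which removes the arbitrary enumeration. The
  coefficients \<open>k\<close> serve necessity, the dual vectors \<open>b\<close>
  sufficiency.\<close>

lemma cut_rank_factorisation:
  fixes G :: "('v, 'p) network"
  assumes G: "network G" and \<Omega>: "\<Omega> \<subseteq> nodes G"
  obtains J k b where "J \<subseteq> (\<Union>V\<in>nodes G - \<Omega>. inp G V)" "card J = cut_rank TYPE('q::field) G \<Omega>"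
    "\<And>e c. e \<in> (\<Union>V\<in>\<Omega>. outp G V) \<Longrightarrow> c \<in> (\<Union>V\<in>nodes G - \<Omega>. inp G V) \<Longrightarrow>
       of_bool ((e, c) \<in> edges G) = (\<Sum>j\<in>J. k c j * of_bool ((e, j) \<in> edges G) :: 'q)"
    "\<And>j l. j \<in> J \<Longrightarrow> l \<in> J \<Longrightarrow>
       (\<Sum>e\<in>(\<Union>V\<in>\<Omega>. outp G V). of_bool ((e, j) \<in> edges G) * b l e :: 'q) = of_bool (j = l)"
proof -
  let ?R = "\<Union>V\<in>\<Omega>. outp G V" and ?C = "\<Union>V\<in>nodes G - \<Omega>. inp G V"
  define rs where "rs = enum_list ?R"
  define cs where "cs = enum_list ?C"
  have "finite (nodes G)" using G by (simp add: network_def)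
  then have fin: "finite ?R" "finite ?C"
    using G \<Omega> by (auto simp: network_def intro: finite_subset)
  have enum: "distinct (enum_list A) \<and> set (enum_list A) = A" if "finite A" for A :: "'p set"
    unfolding enum_list_def by (rule someI_ex) (use finite_distinct_list[OF that] in blast)
  have rs: "distinct rs" "set rs = ?R" and cs: "distinct cs" "set cs = ?C"
    using enum[OF fin(1)] enum[OF fin(2)] by (auto simp: rs_def cs_def)
  define M :: "'q mat" where "M = cut_matrix G \<Omega>"
  have M: "M \<in> carrier_mat (length rs) (length cs)"
    and Mij: "\<And>i j. i < length rs \<Longrightarrow> j < length cs \<Longrightarrow> M $$ (i, j) = of_bool ((rs ! i, cs ! j) \<in> edges G)"
    by (auto simp: M_def cut_matrix_def rs_def cs_def)
  have rk: "cut_rank TYPE('q) G \<Omega> = vec_space.rank (length rs) M"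
    using M by (simp add: cut_rank_def M_def Let_def)
  obtain J k b where J: "J \<subseteq> {..<length cs}" "card J = vec_space.rank (length rs) M"
    "\<And>i c. i < length rs \<Longrightarrow> c < length cs \<Longrightarrow> M $$ (i, c) = (\<Sum>j\<in>J. k c j * M $$ (i, j))"
    "\<And>j l. j \<in> J \<Longrightarrow> l \<in> J \<Longrightarrow> (\<Sum>i<length rs. M $$ (i, j) * b l i) = (if j = l then 1 else 0)"
    by (rule vec_space.rank_factorisation[OF M]) blast
  define ri where "ri = the_inv_into {..<length rs} ((!) rs)"
  define ci where "ci = the_inv_into {..<length cs} ((!) cs)"
  have injr: "inj_on ((!) rs) {..<length rs}" and injc: "inj_on ((!) cs) {..<length cs}"
    using rs cs by (auto simp: inj_on_def nth_eq_iff_index_eq)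
  have ri: "ri (rs ! i) = i" if "i < length rs" for i
    using the_inv_into_f_f[OF injr] that by (simp add: ri_def)
  have ci: "ci (cs ! i) = i" if "i < length cs" for i
    using the_inv_into_f_f[OF injc] that by (simp add: ci_def)
  have ltJ: "j < length cs" if "j \<in> J" for j using J(1) that by auto
  have injJ: "inj_on ((!) cs) J" using injc J(1) by (rule inj_on_subset)
  have bijr: "bij_betw ((!) rs) {..<length rs} ?R"
    using rs by (metis bij_betw_nth)
  show ?thesis
  proof (rule that[of "(!) cs ` J" "\<lambda>c j. k (ci c) (ci j)" "\<lambda>l e. b (ci l) (ri e)"])
    show "(!) cs ` J \<subseteq> ?C" unfolding cs(2)[symmetric] using ltJ by auto
    show "card ((!) cs ` J) = cut_rank TYPE('q) G \<Omega>"
      using J(2) rk injJ by (simp add: card_image)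
  next
    fix e c assume "e \<in> ?R" "c \<in> ?C"
    then obtain i m where im: "i < length rs" "e = rs ! i" "m < length cs" "c = cs ! m"
      unfolding rs(2)[symmetric] cs(2)[symmetric] in_set_conv_nth by blast
    have "(\<Sum>j\<in>(!) cs ` J. k (ci c) (ci j) * of_bool ((e, j) \<in> edges G)) =
          (\<Sum>j\<in>J. k m j * M $$ (i, j))"
      unfolding sum.reindex[OF injJ] im(2,4) by (intro sum.cong refl) (simp add: ci Mij im(1,3) ltJ)
    then show "of_bool ((e, c) \<in> edges G) =
         (\<Sum>j\<in>(!) cs ` J. k (ci c) (ci j) * of_bool ((e, j) \<in> edges G))"
      using J(3)[of i m] im by (simp add: Mij)
  next
    fix j l assume "j \<in> (!) cs ` J" "l \<in> (!) cs ` J"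
    then obtain j' l' where jl: "j = cs ! j'" "l = cs ! l'" "j' \<in> J" "l' \<in> J" by auto
    have "(\<Sum>e\<in>?R. of_bool ((e, j) \<in> edges G) * b (ci l) (ri e)) =
          (\<Sum>i<length rs. M $$ (i, j') * b l' i)"
      unfolding sum.reindex_bij_betw[OF bijr, symmetric] jl(1,2)
      by (intro sum.cong refl) (simp add: ci ri Mij jl(3,4) ltJ)
    also have "\<dots> = of_bool (j = l)"
      using J(4)[OF jl(3,4)] inj_on_eq_iff[OF injJ jl(3,4)] by (simp add: jl(1,2))
    finally show "(\<Sum>e\<in>?R. of_bool ((e, j) \<in> edges G) * b (ci l) (ri e)) = of_bool (j = l)" .
  qed
qed

lemma coords_outside: "f \<in> coords L A \<Longrightarrow> a \<notin> A \<Longrightarrow> f a = 0"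
  by (simp add: coords_def)

section \<open>Counting solutions of linear equations\<close>

text \<open>The field is a subset of a type that is already a field, so arithmetic is that of the
  type and only closure is recorded. Zero is no exception for \<open>inverse\<close>, as
  \<open>inverse 0 = 0\<close>.\<close>

locale finite_subfield =
  fixes L :: "'f::field set"
  assumes finite: "finite L"
    and zero: "0 \<in> L"
    and one: "1 \<in> L"
    and add: "a \<in> L \<Longrightarrow> b \<in> L \<Longrightarrow> a + b \<in> L"
    and uminus: "a \<in> L \<Longrightarrow> - a \<in> L"
    and mult: "a \<in> L \<Longrightarrow> b \<in> L \<Longrightarrow> a * b \<in> L"
    and inverse: "a \<in> L \<Longrightarrow> inverse a \<in> L"
begin

lemma sum_mem: "(\<And>i. i \<in> I \<Longrightarrow> f i \<in> L) \<Longrightarrow> sum f I \<in> L"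
  by (induction I rule: infinite_finite_induct) (auto intro: zero add)

lemma divide_mem: "a \<in> L \<Longrightarrow> b \<in> L \<Longrightarrow> a / b \<in> L"
  by (simp add: divide_inverse mult inverse)

lemma coords_mem: "f \<in> coords L A \<Longrightarrow> f a \<in> L"
  using zero by (cases "a \<in> A") (auto simp: coords_def)

lemma card_ge_2: "2 \<le> card L"
proof -
  have "card {0, 1 :: 'f} \<le> card L"
    using finite zero one by (intro card_mono) auto
  then show ?thesis by simp
qed

text \<open>
  Translation along the dual family \<open>b\<close> carries one fibre of the linear map
  \<open>u \<mapsto> (\<Sum>e. g e j * u e)\<^sub>j\<close> to all the \<open>card L ^ card J\<close> others, which are pairwise disjoint.
\<close>
lemma card_affine_solutions:
  assumes R: "finite R" and J: "finite J"
    and b: "\<And>l e. l \<in> J \<Longrightarrow> e \<in> R \<Longrightarrow> b l e \<in> L"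
    and dual: "\<And>j l. j \<in> J \<Longrightarrow> l \<in> J \<Longrightarrow> (\<Sum>e\<in>R. g e j * b l e) = of_bool (j = l)"
  shows "card {u \<in> coords L R. \<forall>j\<in>J. (\<Sum>e\<in>R. g e j * u e) = t j} * card L ^ card J \<le> card L ^ card R"
proof -
  let ?K = "{u \<in> coords L R. \<forall>j\<in>J. (\<Sum>e\<in>R. g e j * u e) = t j}"
  define F where "F = (\<lambda>(u, s) e. if e \<in> R then u e + (\<Sum>l\<in>J. s l * b l e) else 0)"
  have F_dual: "(\<Sum>e\<in>R. g e j * F (u, s) e) = t j + s j" if "u \<in> ?K" "j \<in> J" for u s j
  proof -
    have "(\<Sum>e\<in>R. g e j * F (u, s) e) =
        (\<Sum>e\<in>R. g e j * u e) + (\<Sum>e\<in>R. \<Sum>l\<in>J. g e j * (s l * b l e))"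
      by (simp add: F_def ring_distribs sum.distrib sum_distrib_left)
    also have "(\<Sum>e\<in>R. \<Sum>l\<in>J. g e j * (s l * b l e)) = (\<Sum>l\<in>J. \<Sum>e\<in>R. g e j * (s l * b l e))"
      by (rule sum.swap)
    also have "\<dots> = (\<Sum>l\<in>J. s l * (\<Sum>e\<in>R. g e j * b l e))"
      by (simp add: sum_distrib_left mult.left_commute)
    also have "\<dots> = (\<Sum>l\<in>J. if l = j then s l else 0)"
      using that by (intro sum.cong) (auto simp: dual)
    also have "\<dots> = s j" using that J by simp
    finally show ?thesis using that by simp
  qed
  \<comment> \<open>The functionals read off \<open>s\<close> from the image; cancelling the
    translation then gives \<open>u\<close>.\<close>
  have "inj_on F (?K \<times> coords L J)"
  proof (rule inj_onI, clarify)
    fix u s u' s'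
    assume u: "u \<in> coords L R" "\<forall>j\<in>J. (\<Sum>e\<in>R. g e j * u e) = t j" "s \<in> coords L J"
      and u': "u' \<in> coords L R" "\<forall>j\<in>J. (\<Sum>e\<in>R. g e j * u' e) = t j" "s' \<in> coords L J"
      and eq: "F (u, s) = F (u', s')"
    have "s j = s' j" if "j \<in> J" for j
      using F_dual[of u j s] F_dual[of u' j s'] u u' that eq by simp
    moreover have "s j = s' j" if "j \<notin> J" for j
      using that u(3) u'(3) by (simp add: coords_def)
    ultimately have s: "s = s'" by blast
    have "u e = u' e" if "e \<in> R" for e
      using fun_cong[OF eq, of e] that s by (simp add: F_def)
    moreover have "u e = u' e" if "e \<notin> R" for e
      using that u(1) u'(1) by (simp add: coords_def)
    ultimately show "u = u' \<and> s = s'"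
      using s by blast
  qed
  moreover have "F ` (?K \<times> coords L J) \<subseteq> coords L R"
    by (auto simp: coords_def F_def intro!: add sum_mem mult b)
  ultimately have "card (?K \<times> coords L J) \<le> card (coords L R)"
    by (rule card_inj_on_le) (use R finite in \<open>simp add: finite_coords\<close>)
  then show ?thesis
    using R J by (simp add: card_cartesian_product card_coords)
qed

lemma card_affine_hyperplane:
  assumes K: "finite K" and v: "\<And>a. a \<in> K \<Longrightarrow> v a \<in> L" and c: "c \<in> K" "v c \<noteq> 0"
  shows "card {u \<in> coords L K. (\<Sum>a\<in>K. v a * u a) = t} * card L \<le> card L ^ card K"
proof -
  \<comment> \<open>The dual family of a single functional: the unit vector at \<open>c\<close>,
    scaled by \<open>1 / v c\<close>.\<close>
  have "(\<Sum>a\<in>K. v a * (if a = c then 1 / v c else 0)) = (\<Sum>a\<in>K. if a = c then 1 else 0)"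
    using c by (intro sum.cong) auto
  then have "(\<Sum>a\<in>K. v a * (if a = c then 1 / v c else 0)) = 1" using K c by simp
  then show ?thesis
    using card_affine_solutions[of K "{()}" "\<lambda>_ a. if a = c then 1 / v c else 0" "\<lambda>a _. v a" "\<lambda>_. t"] K v c
    by (simp add: divide_mem one zero)
qed

end

section \<open>Arbitrarily large finite extension fields\<close>

lemma minus_ring_of_type_algebra: "\<ominus>\<^bsub>ring_of_type_algebra\<^esub> a = - (a :: 'f::field)"
proof -
  interpret R: field "ring_of_type_algebra :: 'f ring" by rule
  show ?thesis by (rule R.minus_equality) (auto simp: ring_of_type_algebra_def)
qed

lemma inv_ring_of_type_algebra:
  assumes "a \<noteq> (0 :: 'f::field)"
  shows "inv\<^bsub>ring_of_type_algebra\<^esub> a = inverse a"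
proof -
  interpret R: field "ring_of_type_algebra :: 'f ring" by rule
  show ?thesis by (rule R.comm_inv_char) (use assms in \<open>auto simp: ring_of_type_algebra_def\<close>)
qed

lemma finite_extension_fieldD:
  assumes "finite_extension_field (L :: 'q::{field,finite} alg_closure set)"
  shows "finite_subfield L" "to_ac c \<in> L"
proof -
  interpret R: field "ring_of_type_algebra :: 'q alg_closure ring" by rule
  have sf: "subfield L ring_of_type_algebra" and "finite L"
    using assms by (auto simp: finite_extension_field_def)
  note sub = subringE[OF subfieldE(1)[OF sf]]
  have 0: "0 \<in> L" using sub(2) by (simp add: ring_of_type_algebra_def)
  have inverse: "inverse a \<in> L" if "a \<in> L" for a
  proof (cases "a = 0")
    case False
    then have "a \<in> L - {\<zero>\<^bsub>ring_of_type_algebra\<^esub>}" using that by (simp add: ring_of_type_algebra_def)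
    then show ?thesis using R.subfield_m_inv(1)[OF sf] inv_ring_of_type_algebra[OF False] by force
  qed (simp add: 0)
  show "finite_subfield L"
  proof
    show "1 \<in> L" using sub(3) by (simp add: ring_of_type_algebra_def)
    show "- a \<in> L" if "a \<in> L" for a using sub(5)[OF that] by (simp add: minus_ring_of_type_algebra)
    show "a * b \<in> L" if "a \<in> L" "b \<in> L" for a b
      using sub(6)[OF that] by (simp add: ring_of_type_algebra_def)
    show "a + b \<in> L" if "a \<in> L" "b \<in> L" for a b
      using sub(7)[OF that] by (simp add: ring_of_type_algebra_def)
  qed (use \<open>finite L\<close> 0 inverse in auto)
  show "to_ac c \<in> L" using assms by (auto simp: finite_extension_field_def)
qed

lemma finite_extension_fieldI:
  assumes "finite_subfield (L :: 'q::{field,finite} alg_closure set)" "\<And>c. to_ac c \<in> L"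
  shows "finite_extension_field L"
proof -
  interpret finite_subfield L by fact
  interpret R: field "ring_of_type_algebra :: 'q alg_closure ring" by rule
  have "subring L ring_of_type_algebra"
    by (rule R.subringI) (use minus_ring_of_type_algebra[where ?'f = "'q alg_closure"] one uminus mult add in \<open>auto simp: ring_of_type_algebra_def\<close>)
  then have "subfield L ring_of_type_algebra"
    by (rule R.subfieldI') (use inv_ring_of_type_algebra[where ?'f = "'q alg_closure"] inverse in \<open>auto simp: ring_of_type_algebra_def\<close>)
  then show ?thesis
    using finite assms(2) by (auto simp: finite_extension_field_def)
qed

text \<open>By pigeonhole two iterates of the Frobenius map coincide on a finite field, and
  injectivity cancels the smaller one.\<close>

lemma finite_field_frobenius_period:
  obtains n where "0 < n" "\<And>x :: 'q::{field,finite}. x ^ (CHAR('q) ^ n) = x"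
proof -
  let ?p = "CHAR('q)"
  have p: "prime ?p"
    using prime_CHAR_semidom[where ?'a = 'q] finite_imp_CHAR_pos[where ?'a = 'q] by simp
  define f where "f n = (\<lambda>x :: 'q. x ^ (?p ^ n))" for n
  have inj: "x = y" if "x ^ (?p ^ n) = y ^ (?p ^ n)" for x y :: 'q and n
  proof -
    have "x ^ (?p ^ n) = (x - y) ^ (?p ^ n) + y ^ (?p ^ n)"
      using freshmans_dream'[OF p refl, of "x - y" y] by simp
    then show ?thesis using that by simp
  qed
  have "finite (range f)" by (rule finite_subset[OF subset_UNIV]) simp
  then have "\<not> inj f" using finite_imageD infinite_UNIV_nat by blast
  then obtain a b where ab: "a < b" "f a = f b" by (metis injI linorder_neqE_nat)
  have "x ^ (?p ^ (b - a)) = x" for x :: 'q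
  proof (rule inj)
    have "(x ^ (?p ^ (b - a))) ^ (?p ^ a) = x ^ (?p ^ b)"
      using ab(1) by (simp flip: power_mult power_add)
    then show "(x ^ (?p ^ (b - a))) ^ (?p ^ a) = x ^ (?p ^ a)"
      using fun_cong[OF ab(2), of x] by (simp add: f_def)
  qed
  then show ?thesis using that[of "b - a"] ab(1) by simp
qed

text \<open>
  The fixed field of a high power of the Frobenius map; the polynomial \<open>X\<^sup>m - X\<close> is separable
  since its derivative is the constant \<open>-1\<close>.
\<close>
lemma exists_large_finite_extension:
  obtains L :: "'q::{field,finite} alg_closure set" where "finite_extension_field L" "N < card L"
proof -
  let ?p = "CHAR('q)"
  have p: "prime ?p"
    using prime_CHAR_semidom[where ?'a = 'q] finite_imp_CHAR_pos[where ?'a = 'q] by simp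
  then have p': "prime CHAR('q alg_closure)" by simp
  obtain n where n: "0 < n" "\<And>x :: 'q. x ^ (?p ^ n) = x"
    using finite_field_frobenius_period by blast
  have n': "x ^ ((?p ^ n) ^ k) = x" for x :: 'q and k
    by (induction k) (simp_all add: power_mult n)
  \<comment> \<open>The factor \<open>n\<close> in the exponent makes the power map fix the base
    field; the factor \<open>Suc N\<close> pushes \<open>m\<close> above \<open>N\<close>.\<close>
  define m where "m = ?p ^ (n * Suc N)"
  have m_eq: "m = CHAR('q alg_closure) ^ (n * Suc N)" by (simp add: m_def)
  have "N < 2 ^ N" by (rule less_exp)
  also have "(2::nat) ^ N \<le> ?p ^ N" using p prime_ge_2_nat by (intro power_mono) auto
  also have "\<dots> \<le> m"
  proof -
    have "N \<le> n * Suc N" using n(1) by (cases n) auto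
    then show ?thesis unfolding m_def using prime_ge_1_nat[OF p] by (intro power_increasing) auto
  qed
  finally have Nm: "N < m" .
  have "1 < m" unfolding m_def using p n(1) prime_gt_1_nat by (intro one_less_power) auto
  define L where "L = {x :: 'q alg_closure. x ^ m = x}"
  define P where "P = monom (1 :: 'q alg_closure) m - monom 1 1"
  have poly_P: "poly P x = x ^ m - x" for x by (simp add: P_def poly_monom)
  have "coeff P m = 1" using \<open>1 < m\<close> by (simp add: P_def)
  then have "P \<noteq> 0" "m \<le> degree P" by (auto intro: le_degree)
  have "?p dvd m" unfolding m_def using n(1) by (simp add: dvd_power)
  then have "of_nat m = (0 :: 'q alg_closure)" by (simp add: of_nat_eq_0_iff_char_dvd)
  then have pderiv_P: "poly (pderiv P) x = - 1" for x
    by (simp add: P_def pderiv_diff pderiv_monom poly_monom)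
  have L_roots: "L = {x. poly P x = 0}" by (auto simp: L_def poly_P)
  have finL: "finite L" unfolding L_roots using \<open>P \<noteq> 0\<close> by (rule poly_roots_finite)
  obtain A where A: "size A = degree P" "P = smult (lead_coeff P) (\<Prod>x\<in>#A. [:-x, 1:])"
    using alg_closed_imp_factorization[OF \<open>P \<noteq> 0\<close>] by blast
  \<comment> \<open>A double root would also be a root of the derivative. Hence the
    \<open>degree P\<close> roots in \<open>A\<close> are that many distinct elements of
    \<open>L\<close>.\<close>
  have "count A x \<le> 1" for x
  proof (rule ccontr)
    assume "\<not> ?thesis"
    then have "2 \<le> count A x" by simp
    then have "{#x, x#} \<subseteq># A" by (auto simp: subseteq_mset_def)
    then obtain B where "A = {#x, x#} + B" by (metis mset_subset_eq_exists_conv)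
    then have "P = [:-x, 1:] * ([:-x, 1:] * smult (lead_coeff P) (\<Prod>x\<in>#B. [:-x, 1:]))"
      by (subst A(2)) simp
    then obtain q where "P = [:-x, 1:] * ([:-x, 1:] * q)" by blast
    then have "poly (pderiv P) x = 0" by (simp only: pderiv_mult) simp
    then show False using pderiv_P[of x] by simp
  qed
  then have "size A = card (set_mset A)"
    unfolding size_multiset_overloaded_eq
    by (metis (no_types, lifting) One_nat_def card_eq_sum count_greater_zero_iff le_antisym Suc_leI sum.cong)
  moreover have "set_mset A \<subseteq> L"
  proof
    fix x assume "x \<in># A"
    then obtain B where "A = add_mset x B" by (metis mset_add)
    then have "poly (\<Prod>x\<in>#A. [:-x, 1:]) x = 0" by simp
    then have "poly P x = 0" by (subst A(2)) simp
    then show "x \<in> L" by (simp add: L_roots)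
  qed
  ultimately have "m \<le> card L"
    using A(1) \<open>m \<le> degree P\<close> card_mono[OF finL, of "set_mset A"] by linarith
  \<comment> \<open>Additivity of the \<open>m\<close>-th power covers even and odd characteristic
    alike.\<close>
  have neg1: "(- 1 :: 'q alg_closure) ^ m = - 1"
  proof -
    have "(1 + (- 1)) ^ m = 1 ^ m + (- 1 :: 'q alg_closure) ^ m"
      using p' m_eq by (rule freshmans_dream')
    moreover have "(1 + (- 1 :: 'q alg_closure)) ^ m = 0" using \<open>1 < m\<close> by (simp add: power_0_left)
    ultimately show ?thesis by (simp add: add_eq_0_iff)
  qed
  have "finite_subfield L"
  proof
    show "a + b \<in> L" if "a \<in> L" "b \<in> L" for a b
      using that freshmans_dream'[OF p' m_eq, of a b] by (simp add: L_def)
    show "- a \<in> L" if "a \<in> L" for a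
      using that neg1 power_mult_distrib[of "- 1" a m] by (simp add: L_def)
  qed (use \<open>1 < m\<close> finL in \<open>auto simp: L_def power_mult_distrib power_inverse power_0_left\<close>)
  moreover have "to_ac c \<in> L" for c
  proof -
    have "c ^ m = c" using n'[of c "Suc N"] by (simp only: m_def power_mult)
    then show ?thesis by (simp add: L_def flip: to_ac_power)
  qed
  ultimately have "finite_extension_field L" by (rule finite_extension_fieldI)
  then show ?thesis using that \<open>m \<le> card L\<close> Nm by simp
qed

section \<open>Acyclic networks\<close>

locale acyclic_net =
  fixes G :: "('v, 'p) network"
  assumes acyclic_network: "acyclic_network G"
begin

lemma network: "network G"
  using acyclic_network by (simp add: acyclic_network_def)

lemma finite_nodes: "finite (nodes G)"
  using network by (simp add: network_def)

lemma finite_inp: "V \<in> nodes G \<Longrightarrow> finite (inp G V)"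
  using network by (simp add: network_def)

lemma finite_outp: "V \<in> nodes G \<Longrightarrow> finite (outp G V)"
  using network by (simp add: network_def)

lemma outp_unique: "V \<in> nodes G \<Longrightarrow> W \<in> nodes G \<Longrightarrow> e \<in> outp G V \<Longrightarrow> e \<in> outp G W \<Longrightarrow> V = W"
  using network unfolding network_def disjoint_family_on_def by blast

lemma edge_source:
  assumes "(e, e') \<in> edges G"
  obtains V where "V \<in> nodes G" "e \<in> outp G V"
  using assms network unfolding network_def by blast

lemma finite_outputs: "\<Omega> \<subseteq> nodes G \<Longrightarrow> finite (\<Union>V\<in>\<Omega>. outp G V)"
  using finite_nodes finite_outp by (meson finite_UN_I finite_subset subsetD)

lemma finite_edges_into: "finite {e. (e, e') \<in> edges G}"
proof (rule finite_subset)
  show "{e. (e, e') \<in> edges G} \<subseteq> (\<Union>V\<in>nodes G. outp G V)"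
    by (auto elim: edge_source)
qed (simp add: finite_outputs)

text \<open>Rewrites the symbol arriving at a port as the output signal of \<open>\<Omega>\<close>
  times a column of the cut matrix, provided nothing else feeds the port.\<close>

lemma sum_edges_into:
  assumes \<Omega>: "\<Omega> \<subseteq> nodes G"
    and zero: "\<And>U e. U \<in> nodes G - \<Omega> \<Longrightarrow> e \<in> outp G U \<Longrightarrow> (e, e') \<in> edges G \<Longrightarrow> Y e = 0"
  shows "(\<Sum>e\<in>{e. (e, e') \<in> edges G}. Y e) =
    (\<Sum>e\<in>(\<Union>V\<in>\<Omega>. outp G V). of_bool ((e, e') \<in> edges G) * Y e :: 'f::field)"
proof -
  let ?E = "{e. (e, e') \<in> edges G}" and ?R = "\<Union>V\<in>\<Omega>. outp G V"
  have "sum Y ?E = sum Y (?R \<inter> ?E)"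
  proof (rule sum.mono_neutral_right)
    show "\<forall>e\<in>?E - ?R \<inter> ?E. Y e = 0"
    proof
      fix e assume e: "e \<in> ?E - ?R \<inter> ?E"
      then obtain U where "U \<in> nodes G" "e \<in> outp G U" by (auto elim: edge_source)
      then show "Y e = 0" using zero[of U e] e by blast
    qed
  qed (auto simp: finite_edges_into)
  also have "\<dots> = (\<Sum>e\<in>?R. of_bool ((e, e') \<in> edges G) * Y e)"
    by (rule sum.mono_neutral_cong_left) (auto simp: finite_outputs \<Omega>)
  finally show ?thesis .
qed

text \<open>Well-founded induction along \<open>arcs\<close>, refined to ports: an input port rests
  on the outputs feeding it, an output port on the inputs of its own node.\<close>

lemma port_induct [consumes 2, case_names inp outp]:
  assumes "V \<in> nodes G" "e \<in> inp G V \<union> outp G V"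
    and inp: "\<And>V e'. V \<in> nodes G \<Longrightarrow> e' \<in> inp G V \<Longrightarrow>
      (\<And>U e. U \<in> nodes G \<Longrightarrow> e \<in> outp G U \<Longrightarrow> (e, e') \<in> edges G \<Longrightarrow> P U e) \<Longrightarrow> P V e'"
    and outp: "\<And>V e. V \<in> nodes G \<Longrightarrow> e \<in> outp G V \<Longrightarrow> (\<And>e'. e' \<in> inp G V \<Longrightarrow> P V e') \<Longrightarrow> P V e"
  shows "P V e"
proof -
  have "finite (arcs G)"
    by (rule finite_subset[of _ "nodes G \<times> nodes G"]) (auto simp: arcs_def finite_nodes)
  then have "wf (arcs G)"
    using acyclic_network by (simp add: acyclic_network_def finite_acyclic_wf)
  then have "\<forall>e\<in>inp G V \<union> outp G V. P V e"
    using \<open>V \<in> nodes G\<close>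
  proof (induction V rule: wf_induct_rule)
    case (less V)
    have "P V e'" if "e' \<in> inp G V" for e'
    proof (rule inp[OF less.prems that])
      fix U e assume U: "U \<in> nodes G" "e \<in> outp G U" "(e, e') \<in> edges G"
      then have "(U, V) \<in> arcs G" using less.prems that by (auto simp: arcs_def)
      then show "P U e" using less.IH U by blast
    qed
    then show ?case using outp[OF less.prems] by blast
  qed
  then show ?thesis using assms(2) by blast
qed

lemma port_symbols_outp:
  "port_symbols G S \<mu> \<alpha> \<beta> x Y \<Longrightarrow> V \<in> nodes G \<Longrightarrow> e \<in> outp G V \<Longrightarrow>
     Y e = (\<Sum>e'\<in>inp G V. \<beta> e' e * Y e') + (if V = S then \<Sum>i\<in>{1..\<mu>}. \<alpha> i e * x i else 0)"
  by (simp add: port_symbols_def)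

lemma port_symbols_inp:
  "port_symbols G S \<mu> \<alpha> \<beta> x Y \<Longrightarrow> V \<in> nodes G \<Longrightarrow> e' \<in> inp G V \<Longrightarrow>
     Y e' = (\<Sum>e\<in>{e. (e, e') \<in> edges G}. Y e)"
  by (simp add: port_symbols_def)

lemma port_symbols_lincomb:
  assumes Y: "\<And>i. i \<in> I \<Longrightarrow> port_symbols G S \<mu> \<alpha> \<beta> (x i) (Y i)"
  shows "port_symbols G S \<mu> \<alpha> \<beta> (\<lambda>j. \<Sum>i\<in>I. c i * x i j) (\<lambda>e. \<Sum>i\<in>I. c i * Y i e)"
  unfolding port_symbols_def
proof (intro conjI ballI)
  fix V e assume V: "V \<in> nodes G" "e \<in> outp G V"
  have "(\<Sum>i\<in>I. c i * Y i e) = (\<Sum>i\<in>I. (\<Sum>e'\<in>inp G V. \<beta> e' e * (c i * Y i e')) +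
      (if V = S then \<Sum>j\<in>{1..\<mu>}. \<alpha> j e * (c i * x i j) else 0))"
    by (intro sum.cong refl, subst port_symbols_outp[OF Y V])
      (simp_all add: ring_distribs sum_distrib_left mult.left_commute)
  also have "\<dots> = (\<Sum>i\<in>I. \<Sum>e'\<in>inp G V. \<beta> e' e * (c i * Y i e')) +
      (if V = S then \<Sum>i\<in>I. \<Sum>j\<in>{1..\<mu>}. \<alpha> j e * (c i * x i j) else 0)"
    by (simp add: sum.distrib)
  also have "(\<Sum>i\<in>I. \<Sum>e'\<in>inp G V. \<beta> e' e * (c i * Y i e')) = (\<Sum>e'\<in>inp G V. \<beta> e' e * (\<Sum>i\<in>I. c i * Y i e'))"
    by (subst sum.swap) (simp add: sum_distrib_left)
  also have "(\<Sum>i\<in>I. \<Sum>j\<in>{1..\<mu>}. \<alpha> j e * (c i * x i j)) = (\<Sum>j\<in>{1..\<mu>}. \<alpha> j e * (\<Sum>i\<in>I. c i * x i j))"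
    by (subst sum.swap) (simp add: sum_distrib_left)
  finally show "(\<Sum>i\<in>I. c i * Y i e) = (\<Sum>e'\<in>inp G V. \<beta> e' e * (\<Sum>i\<in>I. c i * Y i e')) +
      (if V = S then \<Sum>j\<in>{1..\<mu>}. \<alpha> j e * (\<Sum>i\<in>I. c i * x i j) else 0)" .
next
  fix V e' assume V: "V \<in> nodes G" "e' \<in> inp G V"
  have "(\<Sum>i\<in>I. c i * Y i e') = (\<Sum>i\<in>I. \<Sum>e\<in>{e. (e, e') \<in> edges G}. c i * Y i e)"
    by (intro sum.cong refl, subst port_symbols_inp[OF Y V]) (simp_all add: sum_distrib_left)
  also have "\<dots> = (\<Sum>e\<in>{e. (e, e') \<in> edges G}. \<Sum>i\<in>I. c i * Y i e)" by (rule sum.swap)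
  finally show "(\<Sum>i\<in>I. c i * Y i e') = (\<Sum>e\<in>{e. (e, e') \<in> edges G}. \<Sum>i\<in>I. c i * Y i e)" .
qed

lemma port_symbols_diff:
  assumes "port_symbols G S \<mu> \<alpha> \<beta> x Y" "port_symbols G S \<mu> \<alpha> \<beta> x' Y'"
  shows "port_symbols G S \<mu> \<alpha> \<beta> (\<lambda>j. x j - x' j) (\<lambda>e. Y e - Y' e)"
  using port_symbols_lincomb[of UNIV S \<mu> \<alpha> \<beta> "\<lambda>b. if b then x else x'" "\<lambda>b. if b then Y else Y'"
      "\<lambda>b. if b then 1 else - 1"] assms
  by (simp add: UNIV_bool)

text \<open>Beyond the cut, an input receives nothing from \<open>\<Omega>\<close> by
  \<open>cut\<close> and nothing from the other nodes by induction; no source symbol enters there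
  either.\<close>

lemma port_symbols_vanish_outside:
  assumes Y: "port_symbols G S \<mu> \<alpha> \<beta> x Y" and \<Omega>: "\<Omega> \<subseteq> nodes G"
    and src: "S \<in> \<Omega> \<or> (\<forall>j\<in>{1..\<mu>}. x j = 0)"
    and cut: "\<And>V e'. V \<in> nodes G - \<Omega> \<Longrightarrow> e' \<in> inp G V \<Longrightarrow>
      (\<Sum>e\<in>(\<Union>V\<in>\<Omega>. outp G V). of_bool ((e, e') \<in> edges G) * Y e) = 0"
    and V: "V \<in> nodes G - \<Omega>" and e: "e \<in> inp G V \<union> outp G V"
  shows "Y e = 0"
proof -
  have "V \<in> nodes G" using V by simp
  then have "V \<notin> \<Omega> \<longrightarrow> Y e = 0"
    using e
  proof (induction rule: port_induct)
    case (inp V e')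
    show ?case
    proof
      assume "V \<notin> \<Omega>"
      have "Y e' = (\<Sum>e\<in>{e. (e, e') \<in> edges G}. Y e)" by (rule port_symbols_inp[OF Y inp(1,2)])
      also have "\<dots> = (\<Sum>e\<in>(\<Union>V\<in>\<Omega>. outp G V). of_bool ((e, e') \<in> edges G) * Y e)"
        by (rule sum_edges_into[OF \<Omega>]) (use inp(3) in blast)
      also have "\<dots> = 0" using cut inp(1,2) \<open>V \<notin> \<Omega>\<close> by simp
      finally show "Y e' = 0" .
    qed
  next
    case (outp V e)
    show ?case
      using outp(3) src by (auto simp: port_symbols_outp[OF Y outp(1,2)])
  qed
  then show ?thesis using V by simp
qed

lemma port_symbols_unique:
  assumes "port_symbols G S \<mu> \<alpha> \<beta> x Y" "port_symbols G S \<mu> \<alpha> \<beta> x' Y'"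
    and "\<And>j. j \<in> {1..\<mu>} \<Longrightarrow> x j = x' j" and "V \<in> nodes G" "e \<in> inp G V \<union> outp G V"
  shows "Y e = Y' e"
  \<comment> \<open>With \<open>\<Omega> = {}\<close> every node lies beyond the cut, and the
    difference of the signals has zero source.\<close>
  using port_symbols_vanish_outside[OF port_symbols_diff[OF assms(1,2)], of "{}" V e] assms(3-)
  by simp

lemma (in finite_subfield) port_symbols_mem:
  assumes "acyclic_network G" and Y: "port_symbols G S \<mu> \<alpha> \<beta> x Y"
    and \<alpha>: "\<And>i e. i \<in> {1..\<mu>} \<Longrightarrow> e \<in> outp G S \<Longrightarrow> \<alpha> i e \<in> L"
    and \<beta>: "\<And>V e' e. V \<in> nodes G \<Longrightarrow> e' \<in> inp G V \<Longrightarrow> e \<in> outp G V \<Longrightarrow> \<beta> e' e \<in> L"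
    and x: "\<And>j. j \<in> {1..\<mu>} \<Longrightarrow> x j \<in> L"
    and "V \<in> nodes G" "e \<in> inp G V \<union> outp G V"
  shows "Y e \<in> L"
proof -
  interpret acyclic_net G by unfold_locales fact
  show ?thesis using assms(6,7)
  proof (induction rule: port_induct)
    case (inp V e')
    show ?case
      unfolding port_symbols_inp[OF Y inp(1,2)]
      by (rule sum_mem) (auto intro: inp(3) elim: edge_source)
  next
    case (outp V e)
    show ?case
      unfolding port_symbols_outp[OF Y outp(1,2)]
      using outp \<alpha> \<beta> x by (auto intro!: add sum_mem mult zero)
  qed
qed

text \<open>
  The symbols demanded behind a cut are determined by the signals at the \<open>cut_rank\<close> many
  input ports whose columns span the cut matrix.
\<close>
lemma card_demands_le_cut_rank:
  fixes L :: "'q::{field,finite} alg_closure set"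
  assumes L: "finite_extension_field L"
    and mem: "\<And>i e. \<alpha> i e \<in> L" "\<And>e' e. \<beta> e' e \<in> L"
    and conn: "\<And>T. T \<in> \<T>' \<Longrightarrow> connection_established G S \<mu> L \<alpha> \<beta> \<epsilon> \<nu> T (dem T)"
    and dem: "\<And>T. T \<in> \<T>' \<Longrightarrow> dem T \<subseteq> {1..\<mu>}"
    and \<Omega>: "\<Omega> \<subseteq> nodes G" "S \<in> \<Omega>" "\<T>' \<subseteq> nodes G - \<Omega>"
  shows "card (\<Union>T\<in>\<T>'. dem T) \<le> cut_rank TYPE('q) G \<Omega>"
proof -
  interpret L: finite_subfield L using finite_extension_fieldD(1)[OF L] .
  let ?R = "\<Union>V\<in>\<Omega>. outp G V" and ?D = "\<Union>T\<in>\<T>'. dem T"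
  let ?g = "\<lambda>e e'. of_bool ((e, e') \<in> edges G) :: 'q alg_closure"
  have finD: "finite ?D" using dem by (meson UN_least finite_atLeastAtMost finite_subset)
  obtain J and k :: "'p \<Rightarrow> 'p \<Rightarrow> 'q" and b :: "'p \<Rightarrow> 'p \<Rightarrow> 'q" where
    J: "J \<subseteq> (\<Union>V\<in>nodes G - \<Omega>. inp G V)" "card J = cut_rank TYPE('q) G \<Omega>" and
    k: "\<And>e c. e \<in> ?R \<Longrightarrow> c \<in> (\<Union>V\<in>nodes G - \<Omega>. inp G V) \<Longrightarrow>
       of_bool ((e, c) \<in> edges G) = (\<Sum>j\<in>J. k c j * of_bool ((e, j) \<in> edges G))"
    by (rule cut_rank_factorisation[OF network \<Omega>(1), where ?'q = 'q]) blast
  have finJ: "finite J"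
    using J(1) finite_nodes finite_inp by (meson Diff_iff finite_Diff finite_UN_I finite_subset)
  have k': "?g e c = (\<Sum>j\<in>J. to_ac (k c j) * ?g e j)"
    if "e \<in> ?R" "c \<in> (\<Union>V\<in>nodes G - \<Omega>. inp G V)" for e c
  proof -
    have "to_ac (of_bool P :: 'q) = of_bool P" for P by (cases P) auto
    then show ?thesis using arg_cong[OF k[OF that], of to_ac] by (simp only: to_ac_sum to_ac_mult)
  qed
  define Y where "Y x = (SOME Y. port_symbols G S \<mu> \<alpha> \<beta> x Y)" for x
  have Y: "port_symbols G S \<mu> \<alpha> \<beta> x (Y x)" for x
    unfolding Y_def using port_symbols_exist[OF acyclic_network] by (rule someI_ex)
  \<comment> \<open>The signal at the ports \<open>J\<close>, which stand for independent columns of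
    the cut matrix; padded to lie in \<open>coords L J\<close>.\<close>
  define w where "w x j = (if j \<in> J then \<Sum>e\<in>?R. ?g e j * Y x e else 0)" for x j
  have "inj_on w (coords L ?D)"
  proof (rule inj_onI)
    fix x x' assume x: "x \<in> coords L ?D" "x' \<in> coords L ?D" and eq: "w x = w x'"
    define d where "d e = Y x e - Y x' e" for e
    have d: "port_symbols G S \<mu> \<alpha> \<beta> (\<lambda>j. x j - x' j) d"
      unfolding d_def by (rule port_symbols_diff[OF Y Y])
    have dJ: "(\<Sum>e\<in>?R. ?g e j * d e) = 0" if "j \<in> J" for j
      using fun_cong[OF eq, of j] that by (simp add: w_def d_def right_diff_distrib sum_subtractf)
    \<comment> \<open>The other columns are combinations of those in \<open>J\<close>, so the
      difference \<open>d\<close> crosses the cut nowhere.\<close>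
    have cut: "(\<Sum>e\<in>?R. ?g e c * d e) = 0" if "V \<in> nodes G - \<Omega>" "c \<in> inp G V" for V c
    proof -
      have "(\<Sum>e\<in>?R. ?g e c * d e) = (\<Sum>e\<in>?R. \<Sum>j\<in>J. to_ac (k c j) * (?g e j * d e))"
        using that by (intro sum.cong refl, subst k') (auto simp: sum_distrib_right mult.assoc)
      also have "\<dots> = (\<Sum>j\<in>J. to_ac (k c j) * (\<Sum>e\<in>?R. ?g e j * d e))"
        by (subst sum.swap) (simp add: sum_distrib_left)
      finally show ?thesis by (simp add: dJ)
    qed
    have "x i = x' i" if i: "i \<in> ?D" for i
    proof -
      obtain T where T: "T \<in> \<T>'" "i \<in> dem T" using i by blast
      then obtain n where
        n: "\<And>x Y. (\<forall>j\<in>{1..\<mu>}. x j \<in> L) \<Longrightarrow> port_symbols G S \<mu> \<alpha> \<beta> x Y \<Longrightarrow>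
              (\<Sum>e'\<in>inp G T. \<epsilon> e' (T, n) * Y e') = x i"
        using conn[OF T(1)] unfolding connection_established_def by blast
      have "d e' = 0" if "e' \<in> inp G T" for e'
        by (rule port_symbols_vanish_outside[OF d \<Omega>(1) _ cut, where V = T]) (use \<Omega> T that in auto)
      then have "(\<Sum>e'\<in>inp G T. \<epsilon> e' (T, n) * Y x e') = (\<Sum>e'\<in>inp G T. \<epsilon> e' (T, n) * Y x' e')"
        by (simp add: d_def)
      then show ?thesis using n[OF _ Y, of x] n[OF _ Y, of x'] L.coords_mem[OF x(1)] L.coords_mem[OF x(2)] by simp
    qed
    moreover have "x i = x' i" if "i \<notin> ?D" for i
      using coords_outside[OF x(1) that] coords_outside[OF x(2) that] by simp
    ultimately show "x = x'" by blast
  qed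
  moreover have "w ` coords L ?D \<subseteq> coords L J"
  proof clarify
    fix x assume x: "x \<in> coords L ?D"
    have "Y x e \<in> L" if e: "e \<in> ?R" for e
    proof -
      obtain V where "V \<in> nodes G" "e \<in> inp G V \<union> outp G V" using e \<Omega>(1) by blast
      then show ?thesis
        by (rule L.port_symbols_mem[OF acyclic_network Y mem(1) mem(2) L.coords_mem[OF x]])
    qed
    then show "w x \<in> coords L J"
      by (auto simp: coords_def w_def intro!: L.sum_mem L.mult L.zero L.one)
  qed
  ultimately have "card (coords L ?D) \<le> card (coords L J)"
    by (rule card_inj_on_le) (rule finite_coords[OF finJ L.finite])
  then have "card L ^ card ?D \<le> card L ^ card J"
    by (simp only: card_coords[OF finD] card_coords[OF finJ])
  moreover have "1 < card L" using L.card_ge_2 by simp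
  ultimately have "card ?D \<le> card J" using power_le_imp_le_exp by blast
  then show ?thesis by (simp only: J(2))
qed

end

section \<open>Counting codes\<close>

text \<open>\<open>cut\<close> is the min-cut condition with the rank replaced by the size of a dual
  family over \<open>L\<close>, so the counting needs neither matrices nor the base field.\<close>

locale disjoint_multicast = acyclic_net G + finite_subfield L
  for G :: "('v, 'p) network" and L :: "'f::field set" +
  fixes S :: 'v and \<mu> :: nat and \<T> :: "'v set" and dem :: "'v \<Rightarrow> nat set"
  assumes S: "S \<in> nodes G"
    and \<T>: "\<T> \<subseteq> nodes G" "S \<notin> \<T>"
    and dem: "T \<in> \<T> \<Longrightarrow> dem T \<subseteq> {1..\<mu>}"
    and disj: "disjoint_family_on dem \<T>"
    and cut: "\<Omega> \<subseteq> nodes G \<Longrightarrow> S \<in> \<Omega> \<Longrightarrow>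
      \<exists>J b. J \<subseteq> (\<Union>V\<in>nodes G - \<Omega>. inp G V) \<and> card (\<Union>T\<in>\<T> - \<Omega>. dem T) \<le> card J \<and>
        (\<forall>l\<in>J. \<forall>e\<in>(\<Union>V\<in>\<Omega>. outp G V). b l e \<in> L) \<and>
        (\<forall>j\<in>J. \<forall>l\<in>J. (\<Sum>e\<in>(\<Union>V\<in>\<Omega>. outp G V). of_bool ((e, j) \<in> edges G) * b l e) = of_bool (j = l))"
    and large: "2 ^ card (nodes G) < card L"
begin

definition demands :: "nat set" where
  "demands = (\<Union>T\<in>\<T>. dem T)"

definition sink :: "nat \<Rightarrow> 'v" where
  "sink i = (SOME T. T \<in> \<T> \<and> i \<in> dem T)"

definition outputs :: "'p set" where
  "outputs = (\<Union>V\<in>nodes G. outp G V)"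

definition ports :: "'p set" where
  "ports = (\<Union>V\<in>nodes G. inp G V \<union> outp G V)"

definition owner :: "'p \<Rightarrow> 'v" where
  "owner e = (SOME V. V \<in> nodes G \<and> e \<in> outp G V)"

text \<open>
  A coding scheme is a family of coefficient rows: the row \<open>Inl e\<close> produces the symbol at the output
  port \<open>e\<close>, the row \<open>Inr i\<close> the symbol by which the destination demanding process \<open>i\<close> recovers it.
  The entries of a row are indexed by ports (\<open>Inl\<close>) and, at the source, by processes (\<open>Inr\<close>).
\<close>
definition row_nodes :: "'p + nat \<Rightarrow> 'v" where
  "row_nodes w = (case w of Inl e \<Rightarrow> owner e | Inr i \<Rightarrow> sink i)"

definition rows :: "('p + nat) set" where
  "rows = Inl ` outputs \<union> Inr ` demands"

definition row_supp :: "'p + nat \<Rightarrow> ('p + nat) set" where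
  "row_supp w = Inl ` inp G (row_nodes w) \<union>
     (case w of Inl e \<Rightarrow> if owner e = S then Inr ` {1..\<mu>} else {} | Inr i \<Rightarrow> {})"

definition codes :: "('p + nat \<Rightarrow> 'p + nat \<Rightarrow> 'f) set" where
  "codes = (\<Pi>\<^sub>E w\<in>rows. coords L (row_supp w))"

text \<open>The default \<open>0\<close> matters: outside \<open>rows\<close> a code is
  \<open>undefined\<close>, while every coefficient has to lie in \<open>L\<close>.\<close>

definition code_\<alpha> :: "('p + nat \<Rightarrow> 'p + nat \<Rightarrow> 'f) \<Rightarrow> nat \<Rightarrow> 'p \<Rightarrow> 'f" where
  "code_\<alpha> \<theta> i e = (if e \<in> outp G S then \<theta> (Inl e) (Inr i) else 0)"

definition code_\<beta> :: "('p + nat \<Rightarrow> 'p + nat \<Rightarrow> 'f) \<Rightarrow> 'p \<Rightarrow> 'p \<Rightarrow> 'f" where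
  "code_\<beta> \<theta> e' e = (if e \<in> outputs then \<theta> (Inl e) (Inl e') else 0)"

definition code_\<epsilon> :: "('p + nat \<Rightarrow> 'p + nat \<Rightarrow> 'f) \<Rightarrow> 'p \<Rightarrow> 'v \<times> nat \<Rightarrow> 'f" where
  "code_\<epsilon> \<theta> e' Tk = (if snd Tk \<in> demands then \<theta> (Inr (snd Tk)) (Inl e') else 0)"

text \<open>The code \<open>\<theta>\<close> turns \<open>x\<close> into the symbols \<open>Y\<close>, and all destinations receive \<open>0\<close>.\<close>
definition solves :: "('p + nat \<Rightarrow> 'p + nat \<Rightarrow> 'f) \<Rightarrow> (nat \<Rightarrow> 'f) \<Rightarrow> ('p \<Rightarrow> 'f) \<Rightarrow> bool" where
  "solves \<theta> x Y \<longleftrightarrow>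
     (\<forall>w\<in>rows. (\<Sum>a\<in>row_supp w. case_sum Y x a * \<theta> w a) = case_sum Y (\<lambda>_. 0) w)"

text \<open>These are the guesses: only the edges constrain them, so they can be counted
  independently of any code.\<close>

definition signals :: "('p \<Rightarrow> 'f) set" where
  "signals = {Y \<in> coords L ports.
     \<forall>V\<in>nodes G. \<forall>e'\<in>inp G V. Y e' = (\<Sum>e\<in>{e. (e, e') \<in> edges G}. Y e)}"

text \<open>\<open>S\<close> always belongs, since it can emit nonzero symbols without any nonzero
  input.\<close>

definition active :: "('p \<Rightarrow> 'f) \<Rightarrow> 'v set" where
  "active Y = insert S {V \<in> nodes G. \<exists>e'\<in>inp G V. Y e' \<noteq> 0}"

definition bad :: "(nat \<Rightarrow> 'f) \<Rightarrow> ('p + nat \<Rightarrow> 'p + nat \<Rightarrow> 'f) set" where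
  "bad x = {\<theta> \<in> codes. \<exists>Y\<in>signals. solves \<theta> x Y}"

lemma sink_eq:
  assumes "T \<in> \<T>" "i \<in> dem T"
  shows "sink i = T"
proof -
  have "T' = T" if "T' \<in> \<T>" "i \<in> dem T'" for T'
    using disjoint_family_onD[OF disj that(1) assms(1)] that(2) assms(2) by blast
  then show ?thesis unfolding sink_def by (intro some_equality) (use assms in blast)+
qed

lemma sink:
  assumes "i \<in> demands"
  shows "sink i \<in> \<T>" "i \<in> dem (sink i)"
proof -
  obtain T where T: "T \<in> \<T>" "i \<in> dem T" using assms by (auto simp: demands_def)
  then show "sink i \<in> \<T>" "i \<in> dem (sink i)" using sink_eq[OF T] by simp_all
qed

lemma owner_eq: "V \<in> nodes G \<Longrightarrow> e \<in> outp G V \<Longrightarrow> owner e = V"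
  unfolding owner_def by (rule some_equality) (blast intro: outp_unique)+

lemma owner:
  assumes "e \<in> outputs"
  shows "owner e \<in> nodes G" "e \<in> outp G (owner e)"
proof -
  obtain V where V: "V \<in> nodes G" "e \<in> outp G V" using assms by (auto simp: outputs_def)
  then show "owner e \<in> nodes G" "e \<in> outp G (owner e)" using owner_eq[OF V] by simp_all
qed

lemma demands_subset: "demands \<subseteq> {1..\<mu>}"
  using dem by (auto simp: demands_def)

lemma finite_demands: "finite demands"
  using demands_subset finite_subset by blast

lemma finite_ports: "finite ports"
  using finite_nodes finite_inp finite_outp by (auto simp: ports_def)

lemma finite_all_outputs: "finite outputs"
  unfolding outputs_def by (rule finite_outputs) simp

lemma finite_rows: "finite rows"
  using finite_all_outputs finite_demands by (simp add: rows_def)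

lemma row_nodes_mem: "w \<in> rows \<Longrightarrow> row_nodes w \<in> nodes G"
  using owner(1) sink(1) \<T> by (auto simp: rows_def row_nodes_def)

lemma finite_row_supp: "w \<in> rows \<Longrightarrow> finite (row_supp w)"
  using finite_inp[OF row_nodes_mem] by (auto simp: row_supp_def split: sum.splits)

lemma zero_coords: "(\<lambda>_. 0) \<in> coords L A"
  using zero by (simp add: coords_def)

lemma codes_mem: "\<theta> \<in> codes \<Longrightarrow> w \<in> rows \<Longrightarrow> \<theta> w a \<in> L"
  unfolding codes_def by (rule coords_mem, rule PiE_mem)

lemma code_mem:
  assumes "\<theta> \<in> codes"
  shows "code_\<alpha> \<theta> i e \<in> L" "code_\<beta> \<theta> e' e \<in> L" "code_\<epsilon> \<theta> e' Tk \<in> L"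
  using codes_mem[OF assms] zero S
  by (auto simp: code_\<alpha>_def code_\<beta>_def code_\<epsilon>_def rows_def outputs_def)

lemma finite_codes: "finite codes"
  unfolding codes_def
  by (intro finite_PiE finite_rows finite_coords finite_row_supp finite)

lemma card_codes: "card codes = (\<Prod>w\<in>rows. card L ^ card (row_supp w))"
  unfolding codes_def by (simp add: card_PiE finite_rows card_coords finite_row_supp)

lemma finite_signals: "finite signals"
  unfolding signals_def by (simp add: finite_coords finite_ports finite)

lemma signals_mem: "Y \<in> signals \<Longrightarrow> Y e \<in> L"
  unfolding signals_def by (auto intro: coords_mem)

lemma scale_signals:
  assumes "Y \<in> signals" "c \<in> L"
  shows "(\<lambda>e. c * Y e) \<in> signals"
  using assms mult by (auto simp: signals_def coords_def sum_distrib_left)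

lemma solves_scale:
  assumes "solves \<theta> x Y"
  shows "solves \<theta> (\<lambda>j. c * x j) (\<lambda>e. c * Y e)"
  unfolding solves_def
proof
  fix w assume w: "w \<in> rows"
  have "case_sum (\<lambda>e. c * Y e) (\<lambda>j. c * x j) a = c * case_sum Y x a" for a
    by (cases a) auto
  then have "(\<Sum>a\<in>row_supp w. case_sum (\<lambda>e. c * Y e) (\<lambda>j. c * x j) a * \<theta> w a) =
      c * (\<Sum>a\<in>row_supp w. case_sum Y x a * \<theta> w a)"
    by (simp add: sum_distrib_left mult.assoc)
  also have "\<dots> = case_sum (\<lambda>e. c * Y e) (\<lambda>_. 0) w"
    using assms w by (cases w) (auto simp: solves_def)
  finally show "(\<Sum>a\<in>row_supp w. case_sum (\<lambda>e. c * Y e) (\<lambda>j. c * x j) a * \<theta> w a) =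
      case_sum (\<lambda>e. c * Y e) (\<lambda>_. 0) w" .
qed

lemma bad_scale:
  assumes "\<theta> \<in> bad x" "c \<in> L"
  shows "\<theta> \<in> bad (\<lambda>j. c * x j)"
  using assms scale_signals solves_scale unfolding bad_def by blast

lemma row_sum_Inl:
  assumes "V \<in> nodes G" "e \<in> outp G V"
  shows "(\<Sum>a\<in>row_supp (Inl e). case_sum Y x a * \<theta> (Inl e) a) =
    (\<Sum>e'\<in>inp G V. code_\<beta> \<theta> e' e * Y e') + (if V = S then \<Sum>i\<in>{1..\<mu>}. code_\<alpha> \<theta> i e * x i else 0)"
proof -
  have "e \<in> outputs" using assms by (auto simp: outputs_def)
  then have \<beta>: "code_\<beta> \<theta> e' e = \<theta> (Inl e) (Inl e')" for e' by (simp add: code_\<beta>_def)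
  have supp: "row_supp (Inl e) = Inl ` inp G V \<union> (if V = S then Inr ` {1..\<mu>} else {})"
    using owner_eq[OF assms] by (simp add: row_supp_def row_nodes_def)
  show ?thesis
  proof (cases "V = S")
    case True
    then have \<alpha>: "code_\<alpha> \<theta> i e = \<theta> (Inl e) (Inr i)" for i using assms(2) by (simp add: code_\<alpha>_def)
    have "(\<Sum>a\<in>Inl ` inp G V \<union> Inr ` {1..\<mu>}. case_sum Y x a * \<theta> (Inl e) a) =
        (\<Sum>a\<in>Inl ` inp G V. case_sum Y x a * \<theta> (Inl e) a) + (\<Sum>a\<in>Inr ` {1..\<mu>}. case_sum Y x a * \<theta> (Inl e) a)"
      by (rule sum.union_disjoint) (use finite_inp[OF assms(1)] in auto)
    then show ?thesis using True by (simp add: supp \<alpha> \<beta> sum.reindex mult.commute)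
  next
    case False
    then show ?thesis by (simp add: supp \<beta> sum.reindex mult.commute)
  qed
qed

lemma row_sum_Inr:
  assumes "i \<in> demands"
  shows "(\<Sum>a\<in>row_supp (Inr i). case_sum Y x a * \<theta> (Inr i) a) =
    (\<Sum>e'\<in>inp G (sink i). code_\<epsilon> \<theta> e' (sink i, i) * Y e')"
  using assms by (simp add: row_supp_def row_nodes_def sum.reindex code_\<epsilon>_def mult.commute)

text \<open>\<open>port_symbols\<close> leaves \<open>Y\<close> free away from the ports; cutting it
  off to \<open>0\<close> there puts it into the finite set \<open>signals\<close>.\<close>

lemma bad_if_port_symbols:
  assumes \<theta>: "\<theta> \<in> codes" and x: "x \<in> coords L demands"
    and Y: "port_symbols G S \<mu> (code_\<alpha> \<theta>) (code_\<beta> \<theta>) x Y"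
    and received: "\<And>i. i \<in> demands \<Longrightarrow> (\<Sum>e'\<in>inp G (sink i). code_\<epsilon> \<theta> e' (sink i, i) * Y e') = 0"
  shows "\<theta> \<in> bad x"
proof -
  define Y' where "Y' e = (if e \<in> ports then Y e else 0)" for e
  have eq: "Y' e = Y e" if "V \<in> nodes G" "e \<in> inp G V \<union> outp G V" for V e
    using that by (auto simp: Y'_def ports_def)
  have edge: "Y' e = Y e" if "(e, e') \<in> edges G" for e e'
    using that eq by (auto elim: edge_source)
  have "Y e \<in> L" if "e \<in> ports" for e
  proof -
    from that obtain V where "V \<in> nodes G" "e \<in> inp G V \<union> outp G V"
      unfolding ports_def by blast
    then show ?thesis
      by (rule port_symbols_mem[OF acyclic_network Y code_mem(1)[OF \<theta>] code_mem(2)[OF \<theta>] coords_mem[OF x]])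
  qed
  then have "Y' \<in> coords L ports" by (auto simp: coords_def Y'_def)
  moreover have "Y' e' = (\<Sum>e\<in>{e. (e, e') \<in> edges G}. Y' e)" if "V \<in> nodes G" "e' \<in> inp G V" for V e'
    using port_symbols_inp[OF Y that] eq[OF that(1)] that(2) edge by simp
  ultimately have "Y' \<in> signals" by (auto simp: signals_def)
  moreover have "solves \<theta> x Y'"
    unfolding solves_def
  proof
    fix w assume w: "w \<in> rows"
    have arg: "(\<Sum>a\<in>row_supp w. case_sum Y' x a * \<theta> w a) = (\<Sum>a\<in>row_supp w. case_sum Y x a * \<theta> w a)"
      using eq[OF row_nodes_mem[OF w]]
      by (intro sum.cong refl) (auto simp: row_supp_def split: sum.splits if_splits)
    from w consider e where "w = Inl e" "e \<in> outputs" | i where "w = Inr i" "i \<in> demands"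
      by (auto simp: rows_def)
    then show "(\<Sum>a\<in>row_supp w. case_sum Y' x a * \<theta> w a) = case_sum Y' (\<lambda>_. 0) w"
    proof cases
      case 1
      note o = owner[OF 1(2)]
      show ?thesis
        unfolding arg using port_symbols_outp[OF Y o] eq[OF o(1)] o(2)
        by (simp add: 1(1) row_sum_Inl[OF o])
    next
      case 2
      then show ?thesis unfolding arg using received by (simp add: row_sum_Inr)
    qed
  qed
  ultimately show ?thesis using \<theta> by (auto simp: bad_def)
qed

text \<open>
  Rows at active nodes are constrained by a nontrivial linear equation, which holds for a fraction of
  at most \<open>1 / card L\<close> of all coefficients.
\<close>
lemma card_solving_codes:
  assumes x: "x \<in> coords L demands" "x \<noteq> (\<lambda>_. 0)" and Y: "Y \<in> signals"
  shows "card {\<theta> \<in> codes. solves \<theta> x Y} * card L ^ card {w \<in> rows. row_nodes w \<in> active Y} \<le> card codes"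
proof -
  let ?A = "\<lambda>w. {u \<in> coords L (row_supp w). (\<Sum>a\<in>row_supp w. case_sum Y x a * u a) = case_sum Y (\<lambda>_. 0) w}"
  let ?Q = "\<lambda>w. if row_nodes w \<in> active Y then card L else 1"
  \<comment> \<open>With \<open>Y\<close> fixed the equations decouple, one for each row.\<close>
  have "{\<theta> \<in> codes. solves \<theta> x Y} = (\<Pi>\<^sub>E w\<in>rows. ?A w)"
    by (auto simp: codes_def solves_def PiE_def Pi_def)
  then have 1: "card {\<theta> \<in> codes. solves \<theta> x Y} = (\<Prod>w\<in>rows. card (?A w))"
    by (simp add: card_PiE finite_rows)
  have 2: "card L ^ card {w \<in> rows. row_nodes w \<in> active Y} = (\<Prod>w\<in>rows. ?Q w)"
    using finite_rows by (simp add: prod.If_cases Int_def)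
  have "card (?A w) * ?Q w \<le> card L ^ card (row_supp w)" if w: "w \<in> rows" for w
  proof (cases "row_nodes w \<in> active Y \<and> (\<exists>a\<in>row_supp w. case_sum Y x a \<noteq> 0)")
    case True
    then obtain a where a: "a \<in> row_supp w" "case_sum Y x a \<noteq> 0" by blast
    have "case_sum Y x a \<in> L" for a
      using coords_mem[OF x(1)] signals_mem[OF Y] by (cases a) auto
    then show ?thesis
      using card_affine_hyperplane[where v = "case_sum Y x", OF finite_row_supp[OF w] _ a] True by simp
  next
    case False
    \<comment> \<open>An active node other than \<open>S\<close> has a nonzero input. At
      \<open>S\<close>, which is no destination, the row belongs to an output port and sees all
      demanded symbols, and \<open>x\<close> is nonzero. So an equation without nonzero coefficients
      occurs only at inactive nodes, where the factor is \<open>1\<close>.\<close>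
    have "row_nodes w \<notin> active Y"
    proof
      assume act: "row_nodes w \<in> active Y"
      with False have zero: "case_sum Y x a = 0" if "a \<in> row_supp w" for a using that by blast
      have "row_nodes w = S"
      proof (rule ccontr)
        assume "row_nodes w \<noteq> S"
        then obtain e' where "e' \<in> inp G (row_nodes w)" "Y e' \<noteq> 0"
          using act by (auto simp: active_def)
        then show False using zero[of "Inl e'"] by (simp add: row_supp_def)
      qed
      have "\<exists>e. w = Inl e \<and> owner e = S"
      proof (cases w)
        case (Inr i)
        then have "i \<in> demands" using w by (auto simp: rows_def)
        then have "sink i \<noteq> S" using sink(1) \<T>(2) by blast
        then show ?thesis using \<open>row_nodes w = S\<close> Inr by (simp add: row_nodes_def)
      qed (use \<open>row_nodes w = S\<close> in \<open>simp add: row_nodes_def\<close>)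
      then obtain e where e: "w = Inl e" "owner e = S" by blast
      have "x j = 0" for j
      proof (cases "j \<in> demands")
        case True
        then show ?thesis
          using zero[of "Inr j"] demands_subset e by (auto simp: row_supp_def)
      next
        case False
        then show ?thesis using x(1) by (simp add: coords_def)
      qed
      then show False using x(2) by blast
    qed
    then show ?thesis
      using card_mono[OF finite_coords[OF finite_row_supp[OF w] finite], of "?A w"]
      by (simp add: card_coords finite_row_supp[OF w])
  qed
  then have "(\<Prod>w\<in>rows. card (?A w) * ?Q w) \<le> (\<Prod>w\<in>rows. card L ^ card (row_supp w))"
    by (intro prod_mono) auto
  then show ?thesis unfolding 1 2 card_codes by (simp add: prod.distrib)
qed

lemma inactive_outputs:
  assumes "solves \<theta> x Y" and V: "V \<in> nodes G" "e \<in> outp G V" "V \<notin> active Y"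
  shows "Y e = 0"
proof -
  have "Inl e \<in> rows" using V by (auto simp: rows_def outputs_def)
  then have "(\<Sum>a\<in>row_supp (Inl e). case_sum Y x a * \<theta> (Inl e) a) = Y e"
    using assms(1) by (auto simp: solves_def)
  moreover have "V \<noteq> S" "\<forall>e'\<in>inp G V. Y e' = 0" using V by (auto simp: active_def)
  ultimately show ?thesis unfolding row_sum_Inl[OF V(1,2)] by simp
qed

text \<open>The outputs of \<open>\<Omega>\<close> determine such a signal, since the other outputs
  vanish and the edges fix the inputs. Inputs beyond the active set vanish, so the columns
  \<open>J\<close> impose independent equations on these outputs.\<close>

lemma card_signals_active:
  assumes \<Omega>: "\<Omega> \<subseteq> nodes G" and J: "J \<subseteq> (\<Union>V\<in>nodes G - \<Omega>. inp G V)"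
    and b: "\<forall>l\<in>J. \<forall>e\<in>(\<Union>V\<in>\<Omega>. outp G V). b l e \<in> L"
      "\<forall>j\<in>J. \<forall>l\<in>J. (\<Sum>e\<in>(\<Union>V\<in>\<Omega>. outp G V). of_bool ((e, j) \<in> edges G) * b l e) = of_bool (j = l)"
  shows "card {Y \<in> signals. active Y = \<Omega> \<and> (\<forall>V\<in>nodes G - \<Omega>. \<forall>e\<in>outp G V. Y e = 0)} * card L ^ card J
    \<le> card L ^ card (\<Union>V\<in>\<Omega>. outp G V)"
proof -
  let ?R = "\<Union>V\<in>\<Omega>. outp G V"
  let ?Y = "{Y \<in> signals. active Y = \<Omega> \<and> (\<forall>V\<in>nodes G - \<Omega>. \<forall>e\<in>outp G V. Y e = 0)}"
  let ?K = "{u \<in> coords L ?R. \<forall>j\<in>J. (\<Sum>e\<in>?R. of_bool ((e, j) \<in> edges G) * u e) = 0}"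
  define F where "F Y e = (if e \<in> ?R then Y e else 0 :: 'f)" for Y e
  have finR: "finite ?R" using \<Omega> by (rule finite_outputs)
  have finJ: "finite J"
    using J finite_nodes finite_inp by (meson Diff_iff finite_Diff finite_UN_I finite_subset)
  have "inj_on F ?Y"
  proof (rule inj_onI)
    fix Y Y' assume Y: "Y \<in> ?Y" "Y' \<in> ?Y" and eq: "F Y = F Y'"
    have out: "Y e = Y' e" if "V \<in> nodes G" "e \<in> outp G V" for V e
    proof (cases "V \<in> \<Omega>")
      case True
      then show ?thesis using fun_cong[OF eq, of e] that by (auto simp: F_def split: if_splits)
    next
      case False
      then show ?thesis using Y that by simp
    qed
    have edge: "Y e = Y' e" if "(e, e') \<in> edges G" for e e'
      using that out by (blast elim: edge_source)
    have inp: "Y e' = Y' e'" if "V \<in> nodes G" "e' \<in> inp G V" for V e'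
    proof -
      have "Y e' = (\<Sum>e\<in>{e. (e, e') \<in> edges G}. Y e)" "Y' e' = (\<Sum>e\<in>{e. (e, e') \<in> edges G}. Y' e)"
        using Y that by (auto simp: signals_def)
      moreover have "(\<Sum>e\<in>{e. (e, e') \<in> edges G}. Y e) = (\<Sum>e\<in>{e. (e, e') \<in> edges G}. Y' e)"
        by (rule sum.cong) (auto dest: edge)
      ultimately show ?thesis by simp
    qed
    show "Y = Y'"
    proof
      fix e
      show "Y e = Y' e"
      proof (cases "e \<in> ports")
        case True
        then obtain V where "V \<in> nodes G" "e \<in> inp G V \<or> e \<in> outp G V" unfolding ports_def by blast
        then show ?thesis using out inp by blast
      next
        case False
        then have "Y e = 0" "Y' e = 0"
          using Y by (auto simp: signals_def coords_outside)
        then show ?thesis by simp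
      qed
    qed
  qed
  moreover have "F ` ?Y \<subseteq> ?K"
  proof (rule image_subsetI)
    fix Y assume "Y \<in> ?Y"
    then have Y: "Y \<in> signals" "\<Omega> = active Y" and zero: "\<forall>V\<in>nodes G - \<Omega>. \<forall>e\<in>outp G V. Y e = 0"
      by auto
    have "(\<Sum>e\<in>?R. of_bool ((e, j) \<in> edges G) * F Y e) = 0" if j: "j \<in> J" for j
    proof -
      obtain V where V: "V \<in> nodes G" "V \<notin> \<Omega>" "j \<in> inp G V" using j J by blast
      have "(\<Sum>e\<in>?R. of_bool ((e, j) \<in> edges G) * F Y e) = (\<Sum>e\<in>?R. of_bool ((e, j) \<in> edges G) * Y e)"
        by (rule sum.cong) (auto simp: F_def)
      also have "\<dots> = (\<Sum>e\<in>{e. (e, j) \<in> edges G}. Y e)"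
        by (rule sum_edges_into[OF \<Omega>, symmetric]) (use zero in blast)
      also have "\<dots> = Y j" using Y(1) V by (auto simp: signals_def)
      also have "\<dots> = 0" using V Y(2) by (auto simp: active_def)
      finally show ?thesis .
    qed
    moreover have "F Y \<in> coords L ?R" using signals_mem[OF Y(1)] by (auto simp: coords_def F_def)
    ultimately show "F Y \<in> ?K" by blast
  qed
  ultimately have "card ?Y \<le> card ?K"
    by (rule card_inj_on_le) (simp add: finite_coords finR finite)
  moreover have "card ?K * card L ^ card J \<le> card L ^ card ?R"
    by (rule card_affine_solutions[where b = b and t = "\<lambda>_. 0", OF finR finJ]) (use b in auto)
  ultimately show ?thesis by (meson le_trans mult_le_mono1)
qed

text \<open>Bounds are stated as products, which avoids division and truncated subtraction; the
  power with exponent \<open>card ?R\<close> is cancelled near the end.\<close>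

lemma card_bad_active:
  assumes x: "x \<in> coords L demands" "x \<noteq> (\<lambda>_. 0)" and \<Omega>: "\<Omega> \<subseteq> nodes G" "S \<in> \<Omega>"
  shows "card {\<theta> \<in> codes. \<exists>Y\<in>signals. active Y = \<Omega> \<and> solves \<theta> x Y} * card L ^ card demands \<le> card codes"
    (is "card ?B * _ \<le> _")
proof -
  let ?R = "\<Union>V\<in>\<Omega>. outp G V"
  let ?Y = "{Y \<in> signals. active Y = \<Omega> \<and> (\<forall>V\<in>nodes G - \<Omega>. \<forall>e\<in>outp G V. Y e = 0)}"
  let ?Sol = "\<lambda>Y. {\<theta> \<in> codes. solves \<theta> x Y}"
  let ?D = "{i \<in> demands. sink i \<in> \<Omega>}"
  obtain J b where J: "J \<subseteq> (\<Union>V\<in>nodes G - \<Omega>. inp G V)" "card (\<Union>T\<in>\<T> - \<Omega>. dem T) \<le> card J"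
    and b: "\<forall>l\<in>J. \<forall>e\<in>?R. b l e \<in> L"
      "\<forall>j\<in>J. \<forall>l\<in>J. (\<Sum>e\<in>?R. of_bool ((e, j) \<in> edges G) * b l e) = of_bool (j = l)"
    using cut[OF \<Omega>] by blast
  have Q: "0 < card L" using card_ge_2 by simp
  have finY: "finite ?Y" using finite_signals by simp
  have "?B \<subseteq> (\<Union>Y\<in>?Y. ?Sol Y)"
  proof
    fix \<theta> assume "\<theta> \<in> ?B"
    then obtain Y where Y: "\<theta> \<in> codes" "Y \<in> signals" "active Y = \<Omega>" "solves \<theta> x Y" by blast
    then have "Y \<in> ?Y" using inactive_outputs[OF Y(4)] by blast
    then show "\<theta> \<in> (\<Union>Y\<in>?Y. ?Sol Y)" using Y(1,4) by blast
  qed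
  then have "card ?B \<le> card (\<Union>Y\<in>?Y. ?Sol Y)"
    by (rule card_mono[rotated]) (use finY finite_codes in simp)
  also have "\<dots> \<le> (\<Sum>Y\<in>?Y. card (?Sol Y))" using finY by (rule card_UN_le)
  finally have B: "card ?B \<le> (\<Sum>Y\<in>?Y. card (?Sol Y))" .
  have card_rows: "card {w \<in> rows. row_nodes w \<in> \<Omega>} = card ?R + card ?D"
  proof -
    have "e \<in> outputs \<and> owner e \<in> \<Omega> \<longleftrightarrow> e \<in> ?R" for e
    proof
      assume "e \<in> outputs \<and> owner e \<in> \<Omega>"
      then show "e \<in> ?R" using owner(2) by blast
    next
      assume "e \<in> ?R"
      then obtain V where V: "V \<in> \<Omega>" "V \<in> nodes G" "e \<in> outp G V" using \<Omega>(1) by blast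
      then show "e \<in> outputs \<and> owner e \<in> \<Omega>"
        using owner_eq[OF V(2,3)] by (auto simp: outputs_def)
    qed
    then have "{e \<in> outputs. owner e \<in> \<Omega>} = ?R" by blast
    moreover have "{w \<in> rows. row_nodes w \<in> \<Omega>} = Inl ` {e \<in> outputs. owner e \<in> \<Omega>} \<union> Inr ` ?D"
      by (auto simp: rows_def row_nodes_def)
    moreover have "finite ?R" "finite ?D"
      using finite_outputs[OF \<Omega>(1)] finite_demands by simp_all
    ultimately show ?thesis
      by (simp only:, subst card_Un_disjoint) (auto simp: card_image)
  qed
  have "card (?Sol Y) * card L ^ (card ?R + card ?D) \<le> card codes" if "Y \<in> ?Y" for Y
  proof -
    have "Y \<in> signals" "active Y = \<Omega>" using that by blast+
    then show ?thesis using card_solving_codes[OF x, of Y] card_rows by simp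
  qed
  then have "(\<Sum>Y\<in>?Y. card (?Sol Y)) * card L ^ (card ?R + card ?D) \<le> card ?Y * card codes"
    unfolding sum_distrib_right by (rule sum_bounded_above[where 'a = nat, simplified])
  with B have "card ?B * card L ^ (card ?R + card ?D) \<le> card ?Y * card codes"
    by (meson le_trans mult_le_mono1)
  then have "card ?B * card L ^ (card ?R + card ?D) * card L ^ card J \<le> card ?Y * card codes * card L ^ card J"
    by (rule mult_le_mono1)
  also have "\<dots> = (card ?Y * card L ^ card J) * card codes" by simp
  also have "\<dots> \<le> card L ^ card ?R * card codes"
    by (rule mult_le_mono1) (rule card_signals_active[OF \<Omega>(1) J(1) b])
  finally have "card L ^ card ?R * (card ?B * card L ^ (card ?D + card J)) \<le> card L ^ card ?R * card codes"
    by (simp add: power_add mult_ac)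
  then have 1: "card ?B * card L ^ (card ?D + card J) \<le> card codes"
    using Q by simp
  \<comment> \<open>Demands outside \<open>\<Omega>\<close> are paid for by the columns
    \<open>J\<close>, those inside by the rows of their sinks.\<close>
  have "demands \<subseteq> ?D \<union> (\<Union>T\<in>\<T> - \<Omega>. dem T)" using sink by blast
  moreover have fin: "finite (?D \<union> (\<Union>T\<in>\<T> - \<Omega>. dem T))"
    by (rule finite_subset[OF _ finite_demands]) (auto simp: demands_def)
  ultimately have "card demands \<le> card (?D \<union> (\<Union>T\<in>\<T> - \<Omega>. dem T))" by (simp add: card_mono)
  also have "\<dots> \<le> card ?D + card J"
    using card_Un_le[of ?D "\<Union>T\<in>\<T> - \<Omega>. dem T"] J(2) by linarith
  finally have "card L ^ card demands \<le> card L ^ (card ?D + card J)"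
    using Q by (intro power_increasing) auto
  then show ?thesis using 1 by (meson le_trans mult_le_mono2)
qed

lemma card_bad:
  assumes x: "x \<in> coords L demands" "x \<noteq> (\<lambda>_. 0)"
  shows "card (bad x) * card L ^ card demands \<le> 2 ^ card (nodes G) * card codes"
proof -
  let ?B = "\<lambda>\<Omega>. {\<theta> \<in> codes. \<exists>Y\<in>signals. active Y = \<Omega> \<and> solves \<theta> x Y}"
  let ?P = "{\<Omega>. \<Omega> \<subseteq> nodes G \<and> S \<in> \<Omega>}"
  have P: "?P \<subseteq> Pow (nodes G)" by blast
  then have finP: "finite ?P" using finite_nodes finite_subset by blast
  have "active Y \<in> ?P" for Y using S by (auto simp: active_def)
  then have "bad x \<subseteq> (\<Union>\<Omega>\<in>?P. ?B \<Omega>)" by (auto simp: bad_def)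
  then have "card (bad x) \<le> card (\<Union>\<Omega>\<in>?P. ?B \<Omega>)"
    by (rule card_mono[rotated]) (use finP finite_codes in simp)
  also have "\<dots> \<le> (\<Sum>\<Omega>\<in>?P. card (?B \<Omega>))" using finP by (rule card_UN_le)
  finally have "card (bad x) * card L ^ card demands \<le> (\<Sum>\<Omega>\<in>?P. card (?B \<Omega>)) * card L ^ card demands"
    by (rule mult_le_mono1)
  also have "\<dots> \<le> card ?P * card codes"
    unfolding sum_distrib_right
    by (rule sum_bounded_above[where 'a = nat, simplified]) (use card_bad_active[OF x] in auto)
  also have "card ?P \<le> 2 ^ card (nodes G)"
    using card_mono[OF _ P] finite_nodes by (simp add: card_Pow)
  finally show ?thesis by simp
qed

text \<open>
  A union bound over all nonzero inputs would just fail.  Failing inputs come in punctured lines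
  with \<open>card L - 1\<close> elements, so it suffices that \<open>2 ^ card (nodes G) < card L\<close>.
\<close>
lemma exists_good_code:
  obtains \<theta> where "\<theta> \<in> codes" "\<And>x. x \<in> coords L demands \<Longrightarrow> x \<noteq> (\<lambda>_. 0) \<Longrightarrow> \<theta> \<notin> bad x"
proof (rule ccontr)
  note good = that
  assume no: "\<not> thesis"
  let ?I = "coords L demands - {\<lambda>_. 0}"
  let ?m = "card L ^ card demands"
  have finI: "finite ?I" by (simp add: finite_coords finite_demands finite)
  have cardI: "card ?I = ?m - 1"
    using card_Diff_singleton[OF zero_coords, of demands] by (simp add: card_coords finite_demands)
  \<comment> \<open>If a code fails on \<open>x\<close>, it fails on all nonzero multiples of
    \<open>x\<close>.\<close>
  have "card L - 1 \<le> card {x \<in> ?I. \<theta> \<in> bad x}" if \<theta>: "\<theta> \<in> codes" for \<theta>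
  proof -
    obtain x where x: "x \<in> coords L demands" "x \<noteq> (\<lambda>_. 0)" "\<theta> \<in> bad x" using no good[OF \<theta>] by blast
    then obtain i where i: "x i \<noteq> 0" by blast
    have "inj_on (\<lambda>c j. c * x j) (L - {0})"
    proof (rule inj_onI)
      fix c c' assume "(\<lambda>j. c * x j) = (\<lambda>j. c' * x j)"
      from fun_cong[OF this, of i] show "c = c'" using i by simp
    qed
    moreover have "(\<lambda>c j. c * x j) ` (L - {0}) \<subseteq> {x \<in> ?I. \<theta> \<in> bad x}"
    proof clarify
      fix c assume c: "c \<in> L" "c \<noteq> 0"
      then have "(\<lambda>j. c * x j) \<in> coords L demands" using x(1) mult by (auto simp: coords_def)
      moreover have "(\<lambda>j. c * x j) \<noteq> (\<lambda>_. 0)" using i c by (auto dest: fun_cong[of _ _ i])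
      ultimately show "(\<lambda>j. c * x j) \<in> ?I \<and> \<theta> \<in> bad (\<lambda>j. c * x j)"
        using bad_scale[OF x(3) c(1)] by simp
    qed
    ultimately have "card (L - {0}) \<le> card {x \<in> ?I. \<theta> \<in> bad x}"
      by (rule card_inj_on_le) (use finI in simp)
    then show ?thesis using zero by (simp add: card_Diff_singleton)
  qed
  then have "card codes * (card L - 1) \<le> (\<Sum>\<theta>\<in>codes. card {x \<in> ?I. \<theta> \<in> bad x})"
    by (rule sum_bounded_below[where 'a = nat, simplified])
  \<comment> \<open>Double counting of failing pairs of a code and an input.\<close>
  also have "\<dots> = (\<Sum>x\<in>?I. card {\<theta> \<in> codes. \<theta> \<in> bad x})"
    using finite_codes finI by (rule sum_multicount_gen) simp
  also have "\<dots> = (\<Sum>x\<in>?I. card (bad x))"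
    by (intro sum.cong arg_cong[where f = card]) (auto simp: bad_def)
  finally have "card codes * (card L - 1) * ?m \<le> (\<Sum>x\<in>?I. card (bad x)) * ?m"
    by (rule mult_le_mono1)
  also have "\<dots> \<le> card ?I * (2 ^ card (nodes G) * card codes)"
    unfolding sum_distrib_right
    by (rule sum_bounded_above[where 'a = nat, simplified]) (use card_bad in auto)
  \<comment> \<open>By \<open>large\<close>, \<open>2 ^ card (nodes G)\<close> is at most
    \<open>card L - 1\<close>. The omitted zero input, the \<open>1\<close> in
    \<open>?m - 1\<close>, is what yields the contradiction.\<close>
  also have "\<dots> \<le> (?m - 1) * ((card L - 1) * card codes)"
    unfolding cardI using large by (intro mult_le_mono) auto
  finally have "(card codes * (card L - 1)) * ?m \<le> (card codes * (card L - 1)) * (?m - 1)"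
    by (simp add: mult_ac)
  moreover have "0 < card codes"
    unfolding card_codes using card_ge_2 by (intro prod_pos) auto
  then have "0 < card codes * (card L - 1)" using card_ge_2 by simp
  ultimately have "?m \<le> ?m - 1" unfolding mult_le_cancel1 by blast
  moreover have "0 < ?m" using card_ge_2 by simp
  ultimately show False by linarith
qed

text \<open>
  The end-to-end map of a good code is injective on the finite set \<open>coords L demands\<close>, hence
  bijective, and the source inverts it.
\<close>
lemma exists_solution:
  "\<exists>\<alpha> \<beta> \<epsilon>. (\<forall>i e. \<alpha> i e \<in> L) \<and> (\<forall>e' e. \<beta> e' e \<in> L) \<and> (\<forall>e' Tk. \<epsilon> e' Tk \<in> L) \<and>
     (\<forall>T\<in>\<T>. connection_established G S \<mu> L \<alpha> \<beta> \<epsilon> (\<lambda>_. \<mu>) T (dem T))"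
proof -
  obtain \<theta> where \<theta>: "\<theta> \<in> codes"
    and good: "\<And>x. x \<in> coords L demands \<Longrightarrow> x \<noteq> (\<lambda>_. 0) \<Longrightarrow> \<theta> \<notin> bad x"
    using exists_good_code by blast
  let ?\<alpha> = "code_\<alpha> \<theta>" and ?\<beta> = "code_\<beta> \<theta>" and ?\<epsilon> = "code_\<epsilon> \<theta>"
  define Y where "Y x = (SOME Y. port_symbols G S \<mu> ?\<alpha> ?\<beta> x Y)" for x
  have Y: "port_symbols G S \<mu> ?\<alpha> ?\<beta> x (Y x)" for x
    unfolding Y_def using port_symbols_exist[OF acyclic_network] by (rule someI_ex)
  define Z where "Z x i = (if i \<in> demands then \<Sum>e'\<in>inp G (sink i). ?\<epsilon> e' (sink i, i) * Y x e' else 0)" for x i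
  have Z_mem: "Z x \<in> coords L demands" if x: "x \<in> coords L demands" for x
  proof -
    have "Y x e' \<in> L" if "i \<in> demands" "e' \<in> inp G (sink i)" for i e'
    proof (rule port_symbols_mem[OF acyclic_network Y code_mem(1)[OF \<theta>] code_mem(2)[OF \<theta>] coords_mem[OF x]])
      show "sink i \<in> nodes G" using sink(1)[OF that(1)] \<T>(1) by blast
      show "e' \<in> inp G (sink i) \<union> outp G (sink i)" using that(2) by blast
    qed
    then show ?thesis
      unfolding coords_def Z_def using code_mem(3)[OF \<theta>] by (auto intro!: sum_mem mult)
  qed
  have "inj_on Z (coords L demands)"
  proof (rule inj_onI, rule ccontr)
    fix x x' assume x: "x \<in> coords L demands" "x' \<in> coords L demands" and eq: "Z x = Z x'" and "x \<noteq> x'"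
    let ?d = "\<lambda>j. x j - x' j" and ?Y = "\<lambda>e. Y x e - Y x' e"
    have d: "?d \<in> coords L demands"
      using x add[OF _ uminus] by (auto simp: coords_def)
    have "\<theta> \<in> bad ?d"
    proof (rule bad_if_port_symbols[OF \<theta> d port_symbols_diff[OF Y Y]])
      fix i assume "i \<in> demands"
      then show "(\<Sum>e'\<in>inp G (sink i). ?\<epsilon> e' (sink i, i) * ?Y e') = 0"
        using fun_cong[OF eq, of i] by (simp add: Z_def right_diff_distrib sum_subtractf)
    qed
    moreover have "?d \<noteq> (\<lambda>_. 0)" using \<open>x \<noteq> x'\<close> by (auto simp: fun_eq_iff)
    ultimately show False using good d by blast
  qed
  then have "Z ` coords L demands = coords L demands"
    by (intro endo_inj_surj) (auto simp: Z_mem finite_coords finite_demands finite)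
  moreover have "(\<lambda>k. of_bool (k = i)) \<in> coords L demands" if "i \<in> demands" for i
    using that zero one by (auto simp: coords_def)
  ultimately have "\<exists>x\<in>coords L demands. Z x = (\<lambda>k. of_bool (k = i))" if "i \<in> demands" for i
    using that by (metis (no_types, lifting) imageE)
  \<comment> \<open>\<open>\<xi> i\<close> is the source vector that makes the destinations receive
    exactly the unit vector at \<open>i\<close>.\<close>
  then obtain \<xi> where \<xi>: "\<And>i. i \<in> demands \<Longrightarrow> \<xi> i \<in> coords L demands"
    "\<And>i. i \<in> demands \<Longrightarrow> Z (\<xi> i) = (\<lambda>k. of_bool (k = i))"
    by metis
  \<comment> \<open>Sending \<open>x\<close> with \<open>\<alpha>'\<close> amounts to sending the
    combination of the \<open>\<xi> i\<close> with weights \<open>x i\<close>; processes that nobody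
    demands are not sent.\<close>
  define \<alpha>' where "\<alpha>' i e = (if i \<in> demands then \<Sum>j\<in>{1..\<mu>}. \<xi> i j * ?\<alpha> j e else 0)" for i e
  have \<alpha>'_mem: "\<alpha>' i e \<in> L" for i e
    using code_mem(1)[OF \<theta>] coords_mem[OF \<xi>(1)] by (auto simp: \<alpha>'_def zero intro!: sum_mem mult)
  have precode: "(\<Sum>i\<in>{1..\<mu>}. \<alpha>' i e * x i) = (\<Sum>j\<in>{1..\<mu>}. ?\<alpha> j e * (\<Sum>i\<in>demands. x i * \<xi> i j))" for x e
  proof -
    have "(\<Sum>i\<in>{1..\<mu>}. \<alpha>' i e * x i) = (\<Sum>i\<in>demands. \<alpha>' i e * x i)"
      by (rule sum.mono_neutral_right) (use demands_subset in \<open>auto simp: \<alpha>'_def\<close>)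
    also have "\<dots> = (\<Sum>i\<in>demands. \<Sum>j\<in>{1..\<mu>}. ?\<alpha> j e * (x i * \<xi> i j))"
      by (rule sum.cong) (simp_all add: \<alpha>'_def sum_distrib_left mult_ac)
    also have "\<dots> = (\<Sum>j\<in>{1..\<mu>}. \<Sum>i\<in>demands. ?\<alpha> j e * (x i * \<xi> i j))" by (rule sum.swap)
    finally show ?thesis by (simp add: sum_distrib_left)
  qed
  have received: "(\<Sum>e'\<in>inp G T. ?\<epsilon> e' (T, k) * y e') = x k"
    if T: "T \<in> \<T>" "k \<in> dem T" and y: "port_symbols G S \<mu> \<alpha>' ?\<beta> x y" for T k x y
  proof -
    have k: "k \<in> demands" "sink k = T" using T sink_eq[OF T] by (auto simp: demands_def)
    have "port_symbols G S \<mu> ?\<alpha> ?\<beta> (\<lambda>j. \<Sum>i\<in>demands. x i * \<xi> i j) y"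
      using y unfolding port_symbols_def precode .
    moreover have "port_symbols G S \<mu> ?\<alpha> ?\<beta> (\<lambda>j. \<Sum>i\<in>demands. x i * \<xi> i j) (\<lambda>e. \<Sum>i\<in>demands. x i * Y (\<xi> i) e)"
      by (rule port_symbols_lincomb[OF Y])
    \<comment> \<open>Both signals belong to the same precoded source vector, so they agree on all
      ports.\<close>
    ultimately have "y e' = (\<Sum>i\<in>demands. x i * Y (\<xi> i) e')" if "e' \<in> inp G T" for e'
      by (rule port_symbols_unique[where V = T]) (use T(1) \<T>(1) that in auto)
    then have "(\<Sum>e'\<in>inp G T. ?\<epsilon> e' (T, k) * y e') =
        (\<Sum>e'\<in>inp G T. \<Sum>i\<in>demands. x i * (?\<epsilon> e' (T, k) * Y (\<xi> i) e'))"
      by (intro sum.cong refl) (simp add: sum_distrib_left mult.left_commute)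
    also have "\<dots> = (\<Sum>i\<in>demands. \<Sum>e'\<in>inp G T. x i * (?\<epsilon> e' (T, k) * Y (\<xi> i) e'))" by (rule sum.swap)
    also have "\<dots> = (\<Sum>i\<in>demands. x i * Z (\<xi> i) k)"
      using k by (simp add: Z_def sum_distrib_left)
    also have "\<dots> = (\<Sum>i\<in>demands. if k = i then x i else 0)"
      by (rule sum.cong) (simp_all add: \<xi>(2))
    also have "\<dots> = x k" using k(1) finite_demands by simp
    finally show ?thesis .
  qed
  have "connection_established G S \<mu> L \<alpha>' ?\<beta> ?\<epsilon> (\<lambda>_. \<mu>) T (dem T)" if "T \<in> \<T>" for T
    unfolding connection_established_def
  proof
    fix k assume k: "k \<in> dem T"
    \<comment> \<open>Output components carry the number of the process they deliver, which is why
      \<open>\<mu>\<close> components suffice at every destination.\<close>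
    then have "k \<in> {1..\<mu>}" using dem[OF that] by blast
    then show "\<exists>n\<in>{1..\<mu>}. \<forall>x Y. (\<forall>j\<in>{1..\<mu>}. x j \<in> L) \<longrightarrow> port_symbols G S \<mu> \<alpha>' ?\<beta> x Y \<longrightarrow>
        (\<Sum>e'\<in>inp G T. ?\<epsilon> e' (T, n) * Y e') = x k"
      using received[OF that k] by blast
  qed
  then show ?thesis using \<alpha>'_mem code_mem(2,3)[OF \<theta>] by blast
qed

end

section \<open>Equivalence of solvability and the min-cut bound\<close>

theorem theorem8:
  fixes G :: "('v, 'p) network" and S :: 'v and \<mu> :: nat
    and \<T> :: "'v set" and dem :: "'v \<Rightarrow> nat set"
  assumes "acyclic_network G"
    and "S \<in> nodes G"
    and "\<mu> \<le> card (outp G S)"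
    and "\<T> \<subseteq> nodes G" and "S \<notin> \<T>"
    and "\<And>T. T \<in> \<T> \<Longrightarrow> dem T \<subseteq> {1..\<mu>}"
    and "disjoint_family_on dem \<T>"
  shows "solvable TYPE('q::{field,finite}) G S \<mu> (connections S \<T> dem) \<longleftrightarrow>
    (\<forall>\<T>'. \<T>' \<subseteq> \<T> \<and> \<T>' \<noteq> {} \<longrightarrow>
       mincut TYPE('q) G S \<T>' \<ge> (\<Sum>T\<in>\<T>'. card (dem T)))"
proof -
  interpret acyclic_net G by unfold_locales fact
  have card_dem: "card (\<Union>T\<in>\<T>'. dem T) = (\<Sum>T\<in>\<T>'. card (dem T))" if "\<T>' \<subseteq> \<T>" for \<T>'
  proof (rule card_UN_disjoint)
    show "finite \<T>'" using that assms(4) finite_nodes by (meson finite_subset)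
    show "\<forall>T\<in>\<T>'. finite (dem T)" using that assms(6) by (meson finite_atLeastAtMost finite_subset subsetD)
    show "\<forall>T\<in>\<T>'. \<forall>T'\<in>\<T>'. T \<noteq> T' \<longrightarrow> dem T \<inter> dem T' = {}"
      using that assms(7) by (meson disjoint_family_onD subsetD)
  qed
  define cuts where "cuts \<T>' = {\<Omega>. \<Omega> \<subseteq> nodes G \<and> S \<in> \<Omega> \<and> \<T>' \<subseteq> nodes G - \<Omega>}" for \<T>' :: "'v set"
  have "finite (cuts \<T>')" for \<T>'
    by (rule finite_subset[of _ "Pow (nodes G)"]) (auto simp: cuts_def finite_nodes)
  then have mincut_ge: "n \<le> mincut TYPE('q) G S \<T>' \<longleftrightarrow> (\<forall>\<Omega>\<in>cuts \<T>'. n \<le> cut_rank TYPE('q) G \<Omega>)"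
    if "\<T>' \<subseteq> \<T>" for n \<T>'
  proof -
    \<comment> \<open>A witness that the minimum ranges over a nonempty set.\<close>
    have "{S} \<in> cuts \<T>'" using that assms(2,4,5) by (auto simp: cuts_def)
    then have "cuts \<T>' \<noteq> {}" by blast
    then show ?thesis
      using \<open>\<And>\<T>'. finite (cuts \<T>')\<close> unfolding mincut_def cuts_def[symmetric] by (subst Min_ge_iff) auto
  qed
  show ?thesis
  proof
    assume "solvable TYPE('q) G S \<mu> (connections S \<T> dem)"
    then obtain L :: "'q alg_closure set" and \<alpha> \<beta> \<epsilon> \<nu> where L: "finite_extension_field L"
      and mem: "\<And>i e. \<alpha> i e \<in> L" "\<And>e' e. \<beta> e' e \<in> L"
      and all: "\<forall>(S', T, D)\<in>connections S \<T> dem.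
        S' = S \<and> connection_established G S \<mu> L \<alpha> \<beta> \<epsilon> \<nu> T D"
      unfolding solvable_def by blast
    have conn: "connection_established G S \<mu> L \<alpha> \<beta> \<epsilon> \<nu> T (dem T)" if "T \<in> \<T>" for T
    proof -
      have "(S, T, dem T) \<in> connections S \<T> dem" using that by (simp add: connections_def)
      from bspec[OF all this] show ?thesis by simp
    qed
    show "\<forall>\<T>'. \<T>' \<subseteq> \<T> \<and> \<T>' \<noteq> {} \<longrightarrow> mincut TYPE('q) G S \<T>' \<ge> (\<Sum>T\<in>\<T>'. card (dem T))"
    proof (intro allI impI)
      fix \<T>' assume "\<T>' \<subseteq> \<T> \<and> \<T>' \<noteq> {}"
      then have sub: "\<T>' \<subseteq> \<T>" by simp
      show "mincut TYPE('q) G S \<T>' \<ge> (\<Sum>T\<in>\<T>'. card (dem T))"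
        unfolding mincut_ge[OF sub] card_dem[OF sub, symmetric]
      proof
        fix \<Omega> assume "\<Omega> \<in> cuts \<T>'"
        then show "card (\<Union>T\<in>\<T>'. dem T) \<le> cut_rank TYPE('q) G \<Omega>"
          by (intro card_demands_le_cut_rank[where \<alpha> = \<alpha> and \<beta> = \<beta>, OF L mem conn assms(6)])
            (use sub in \<open>auto simp: cuts_def\<close>)
      qed
    qed
  next
    assume bound: "\<forall>\<T>'. \<T>' \<subseteq> \<T> \<and> \<T>' \<noteq> {} \<longrightarrow> mincut TYPE('q) G S \<T>' \<ge> (\<Sum>T\<in>\<T>'. card (dem T))"
    obtain L :: "'q alg_closure set" where L: "finite_extension_field L" "2 ^ card (nodes G) < card L"
      using exists_large_finite_extension by blast
    interpret L: finite_subfield L using finite_extension_fieldD(1)[OF L(1)] .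
    interpret disjoint_multicast G L S \<mu> \<T> dem
    proof
      show "\<exists>J b. J \<subseteq> (\<Union>V\<in>nodes G - \<Omega>. inp G V) \<and> card (\<Union>T\<in>\<T> - \<Omega>. dem T) \<le> card J \<and>
          (\<forall>l\<in>J. \<forall>e\<in>(\<Union>V\<in>\<Omega>. outp G V). b l e \<in> L) \<and>
          (\<forall>j\<in>J. \<forall>l\<in>J. (\<Sum>e\<in>(\<Union>V\<in>\<Omega>. outp G V). of_bool ((e, j) \<in> edges G) * b l e) = of_bool (j = l))"
        if \<Omega>: "\<Omega> \<subseteq> nodes G" "S \<in> \<Omega>" for \<Omega>
      proof -
        let ?R = "\<Union>V\<in>\<Omega>. outp G V"
        obtain J and b :: "'p \<Rightarrow> 'p \<Rightarrow> 'q" where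
          J: "J \<subseteq> (\<Union>V\<in>nodes G - \<Omega>. inp G V)" "card J = cut_rank TYPE('q) G \<Omega>" and
          b: "\<And>j l. j \<in> J \<Longrightarrow> l \<in> J \<Longrightarrow> (\<Sum>e\<in>?R. of_bool ((e, j) \<in> edges G) * b l e) = of_bool (j = l)"
          by (rule cut_rank_factorisation[OF network \<Omega>(1), where ?'q = 'q]) blast
        have "card (\<Union>T\<in>\<T> - \<Omega>. dem T) \<le> card J"
        \<comment> \<open>The bound is given for nonempty sets of destinations only; if all of them
          lie in \<open>\<Omega>\<close>, there is no demand to account for.\<close>
        proof (cases "\<T> - \<Omega> = {}")
          case True
          then show ?thesis by (simp only:) simp
        next
          case False
          have "\<Omega> \<in> cuts (\<T> - \<Omega>)" using \<Omega> assms(4) by (auto simp: cuts_def)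
          then have "(\<Sum>T\<in>\<T> - \<Omega>. card (dem T)) \<le> cut_rank TYPE('q) G \<Omega>"
            using bound False mincut_ge[of "\<T> - \<Omega>"] by blast
          then show ?thesis by (simp only: card_dem[OF Diff_subset] J(2))
        qed
        \<comment> \<open>The embedding preserves the duality equations, so independence over the
          base field carries over to \<open>L\<close>.\<close>
        moreover have "(\<Sum>e\<in>?R. of_bool ((e, j) \<in> edges G) * to_ac (b l e)) = of_bool (j = l)"
          if "j \<in> J" "l \<in> J" for j l
        proof -
          have of_bool: "to_ac (of_bool P :: 'q) = of_bool P" for P by (cases P) auto
          show ?thesis
            using arg_cong[OF b[OF that], of to_ac] by (simp only: to_ac_sum to_ac_mult of_bool)
        qed
        ultimately show ?thesis
          using J(1) finite_extension_fieldD(2)[OF L(1)]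
          by (intro exI[of _ J] exI[of _ "\<lambda>l e. to_ac (b l e)"]) blast
      qed
    qed (use assms L(2) in auto)
    show "solvable TYPE('q) G S \<mu> (connections S \<T> dem)"
    proof -
      obtain \<alpha> \<beta> \<epsilon> where sol: "\<forall>i e. \<alpha> i e \<in> L" "\<forall>e' e. \<beta> e' e \<in> L" "\<forall>e' Tk. \<epsilon> e' Tk \<in> L"
        and conn: "\<forall>T\<in>\<T>. connection_established G S \<mu> L \<alpha> \<beta> \<epsilon> (\<lambda>_. \<mu>) T (dem T)"
        using exists_solution by blast
      have "\<forall>(S', T, D)\<in>connections S \<T> dem.
          S' = S \<and> connection_established G S \<mu> L \<alpha> \<beta> \<epsilon> (\<lambda>_. \<mu>) T D"
        using conn by (simp add: connections_def)
      then show ?thesis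
        unfolding solvable_def using L(1) sol by blast
    qed
  qed
qed

end
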